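(* Let $(B_0,B_1)$ be an interpolation couple of complex Banach spaces, let $\theta\in(0,1)$ and let $p\in(1,+\infty)$. Assume that the norm on $B_0$ is weakly uniformly rotund. Then the real interpolation space $B_{\theta,p}=(B_0,B_1)_{\theta,p}$ admits an equivalent weakly uniformly rotund norm.
   Context: An interpolation couple $(B_0,B_1)$ is a pair of complex Banach spaces continuously embedded in a common Hausdorff topological vector space. Real interpolation space: for $a\in B_0+B_1$ and $t>0$ let $K(t,a)=\inf\{\|a_0\|_{B_0}+t\|a_1\|_{B_1}: a=a_0+a_1,\ a_j\in B_j\}$. Then $B_{\theta,p}=\{a\in B_0+B_1: \|a\|_{B_{\theta,p}}=\left[\int_0^\infty (t^{-\theta}K(t,a))^p\frac{dt}{t}\right]^{1/p}<+\infty\}$, a Banach space with this norm. A norm $\|\cdot\|$ on a Banach space $X$ is weakly uniformly rotund (WUR) if $x_n-y_n\to 0$ in the weak topology of $X$ whenever $(x_n),(y_n)$ are sequences in the unit sphere of $X$ with $\lim_{n}\|x_n+y_n\|=2$. *)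

theory Defs
  imports "HOL-Analysis.Analysis"
begin

text \<open>
  The library has no type class of complex normed spaces, and interpolation spaces are proper
  subspaces of an ambient vector space. Normed spaces are therefore given by a carrier \<open>X\<close> in a
  complex vector space and a norm \<open>N\<close>, of which only the values on \<open>X\<close> are relevant.
\<close>

locale complex_normed_space = vector_space scl
  for scl :: "complex \<Rightarrow> 'v::ab_group_add \<Rightarrow> 'v" +
  fixes X :: "'v set" and N :: "'v \<Rightarrow> real"
  assumes subspace_carrier: "subspace X"
    and norm_nonneg: "x \<in> X \<Longrightarrow> 0 \<le> N x"
    and norm_eq_0_iff: "x \<in> X \<Longrightarrow> N x = 0 \<longleftrightarrow> x = 0"
    and norm_scale: "x \<in> X \<Longrightarrow> N (scl c x) = cmod c * N x"
    and norm_triangle: "x \<in> X \<Longrightarrow> y \<in> X \<Longrightarrow> N (x + y) \<le> N x + N y"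
begin

text \<open>The library's \<^locale>\<open>Metric_space\<close> wants the metric to be symmetric and nonnegative also
  outside the carrier, hence the case distinction.\<close>

definition norm_dist :: "'v \<Rightarrow> 'v \<Rightarrow> real" where
  "norm_dist x y = (if x \<in> X \<and> y \<in> X then N (x - y) else 0)"

sublocale norm: Metric_space X norm_dist
proof
  show "0 \<le> norm_dist x y" for x y
    by (simp add: norm_dist_def norm_nonneg subspace_carrier subspace_diff)
  show "norm_dist x y = norm_dist y x" for x y
  proof (cases "x \<in> X \<and> y \<in> X")
    case True
    then have "N (scl (- 1) (y - x)) = cmod (- 1) * N (y - x)"
      by (intro norm_scale subspace_diff subspace_carrier) auto
    with True show ?thesis
      by (simp add: norm_dist_def scale_minus_left)
  qed (auto simp: norm_dist_def)
  show "norm_dist x y = 0 \<longleftrightarrow> x = y" if "x \<in> X" "y \<in> X" for x y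
    using that by (simp add: norm_dist_def norm_eq_0_iff subspace_carrier subspace_diff)
  show "norm_dist x z \<le> norm_dist x y + norm_dist y z"
    if "x \<in> X" "y \<in> X" "z \<in> X" for x y z
    using norm_triangle[of "x - y" "y - z"] that
    by (simp add: norm_dist_def subspace_carrier subspace_diff)
qed

end

locale complex_Banach_space = complex_normed_space +
  assumes complete: "norm.mcomplete"

text \<open>The functionals are defined on the whole ambient type, but are constrained on \<open>X\<close> only;
  every bounded linear functional on \<open>X\<close> arises as a restriction of one of these.\<close>

definition bounded_functionals ::
    "(complex \<Rightarrow> 'v::ab_group_add \<Rightarrow> 'v) \<Rightarrow> 'v set \<Rightarrow> ('v \<Rightarrow> real) \<Rightarrow> ('v \<Rightarrow> complex) set" where
  "bounded_functionals scl X N =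
    {f. (\<forall>x\<in>X. \<forall>y\<in>X. f (x + y) = f x + f y) \<and> (\<forall>c. \<forall>x\<in>X. f (scl c x) = c * f x) \<and>
        (\<exists>M. \<forall>x\<in>X. cmod (f x) \<le> M * N x)}"

definition weak_topology ::
    "(complex \<Rightarrow> 'v::ab_group_add \<Rightarrow> 'v) \<Rightarrow> 'v set \<Rightarrow> ('v \<Rightarrow> real) \<Rightarrow> 'v topology" where
  "weak_topology scl X N =
    topology_generated_by {{x \<in> X. f x \<in> U} |f U. f \<in> bounded_functionals scl X N \<and> open U}"

definition weakly_uniformly_rotund ::
    "(complex \<Rightarrow> 'v::ab_group_add \<Rightarrow> 'v) \<Rightarrow> 'v set \<Rightarrow> ('v \<Rightarrow> real) \<Rightarrow> bool" where
  "weakly_uniformly_rotund scl X N \<longleftrightarrow>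
    complex_Banach_space scl X N \<and>
    (\<forall>x y :: nat \<Rightarrow> 'v.
      (\<forall>n. x n \<in> X \<and> N (x n) = 1) \<longrightarrow> (\<forall>n. y n \<in> X \<and> N (y n) = 1) \<longrightarrow>
      (\<lambda>n. N (x n + y n)) \<longlonglongrightarrow> 2 \<longrightarrow>
      limitin (weak_topology scl X N) (\<lambda>n. x n - y n) 0 sequentially)"

definition equivalent_norms :: "'v set \<Rightarrow> ('v \<Rightarrow> real) \<Rightarrow> ('v \<Rightarrow> real) \<Rightarrow> bool" where
  "equivalent_norms X N N' \<longleftrightarrow> (\<exists>c>0. \<exists>C>0. \<forall>x\<in>X. c * N x \<le> N' x \<and> N' x \<le> C * N x)"

text \<open>The two spaces are identified with their images in the ambient Hausdorff topological vector
  space, which is the type \<open>'v\<close>.\<close>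

locale interpolation_couple =
  B0: complex_Banach_space scl B0 N0 + B1: complex_Banach_space scl B1 N1
  for scl :: "complex \<Rightarrow> 'v::{topological_ab_group_add, t2_space} \<Rightarrow> 'v"
    and B0 :: "'v set" and N0 :: "'v \<Rightarrow> real" and B1 :: "'v set" and N1 :: "'v \<Rightarrow> real" +
  assumes continuous_scale: "continuous_on UNIV (\<lambda>(c, x). scl c x)"
    and continuous_embedding_0: "continuous_map B0.norm.mtopology euclidean (\<lambda>x. x)"
    and continuous_embedding_1: "continuous_map B1.norm.mtopology euclidean (\<lambda>x. x)"

definition K_functional ::
    "'v::ab_group_add set \<Rightarrow> ('v \<Rightarrow> real) \<Rightarrow> 'v set \<Rightarrow> ('v \<Rightarrow> real) \<Rightarrow> real \<Rightarrow> 'v \<Rightarrow> real" where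
  "K_functional B0 N0 B1 N1 t a =
    Inf {N0 a0 + t * N1 a1 |a0 a1. a0 \<in> B0 \<and> a1 \<in> B1 \<and> a = a0 + a1}"

definition real_interp_integral ::
    "'v::ab_group_add set \<Rightarrow> ('v \<Rightarrow> real) \<Rightarrow> 'v set \<Rightarrow> ('v \<Rightarrow> real) \<Rightarrow> real \<Rightarrow> real \<Rightarrow> 'v \<Rightarrow> ennreal" where
  "real_interp_integral B0 N0 B1 N1 \<theta> p a =
    (\<integral>\<^sup>+t\<in>{0<..}. ennreal ((t powr (- \<theta>) * K_functional B0 N0 B1 N1 t a) powr p / t) \<partial>lborel)"

definition real_interp_space ::
    "'v::ab_group_add set \<Rightarrow> ('v \<Rightarrow> real) \<Rightarrow> 'v set \<Rightarrow> ('v \<Rightarrow> real) \<Rightarrow> real \<Rightarrow> real \<Rightarrow> 'v set" where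
  "real_interp_space B0 N0 B1 N1 \<theta> p =
    {a. (\<exists>a0\<in>B0. \<exists>a1\<in>B1. a = a0 + a1) \<and> real_interp_integral B0 N0 B1 N1 \<theta> p a < \<infinity>}"

definition real_interp_norm ::
    "'v::ab_group_add set \<Rightarrow> ('v \<Rightarrow> real) \<Rightarrow> 'v set \<Rightarrow> ('v \<Rightarrow> real) \<Rightarrow> real \<Rightarrow> real \<Rightarrow> 'v \<Rightarrow> real" where
  "real_interp_norm B0 N0 B1 N1 \<theta> p a =
    enn2real (real_interp_integral B0 N0 B1 N1 \<theta> p a) powr (1 / p)"

end

theory Submission
  imports Defs "HOL-Library.Nat_Bijection"
begin

text \<open>
  Discretise the real method: \<open>\<Psi> n x\<close> is the infimum over \<open>x = a + b\<close> of
  \<open>(2^(-\<theta>k) N0 a)^p + (2^((1-\<theta>)k) N1 b)^p\<close>, where \<open>n\<close> enumerates \<open>k \<in> \<int>\<close>, and the new norm is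
  \<open>(\<Sum>n. \<Psi> n x)^(1/p)\<close>. If \<open>x\<close> and \<open>y\<close> run through unit vectors with \<open>x + y\<close> of norm tending to 2,
  then for each \<open>n\<close> the convexity gap of \<open>\<Psi> n\<close> tends to 0, and so does the gap of \<open>N0^p\<close> between the
  \<open>B0\<close>-parts of nearly optimal decompositions; as \<open>N0\<close> is weakly uniformly rotund, the difference of
  the \<open>B0\<close>-parts is weakly null in \<open>B0\<close>. The \<open>B1\<close>-parts are small in \<open>N1\<close> once \<open>k\<close> is large. Hence
  \<open>g (x - y) \<longlonglongrightarrow> 0\<close> for every functional \<open>g\<close> bounded on \<open>B0 + B1\<close>. These approximate any bounded
  functional \<open>R\<close> on the interpolation space: since \<open>p > 1\<close>, a gliding hump yields
  \<open>\<bar>R x\<bar> \<le> \<eta> * lp_norm x + M * sum_norm x\<close>, and the Hahn-Banach theorem splits \<open>R\<close> accordingly.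
\<close>

section \<open>Powers of real numbers\<close>

text \<open>Two obstacles shape the argument. No rotundity is available in \<open>N1\<close>, so the
  \<open>B1\<close>-parts of decompositions cannot be compared through convexity; the weight alone
  makes them small, and the convexity gap of \<open>N1 powr p\<close> is merely nonnegative. This is
  why the cost adds p-th powers: gaps are additive, both over the two norms and over
  \<open>n\<close>. For unit vectors the gaps of all \<open>\<Psi> n\<close> are nonnegative and add
  up to \<open>1 - (lp_norm (x + y) / 2) powr p\<close>, which forces each of them to 0. The other
  obstacle is that a functional bounded on the interpolation space need not make sense on
  \<open>B0\<close>, where the rotundity lives. It has to be replaced, up to a small error in the
  dual norm, by the restriction of a functional bounded on \<open>B0 + B1\<close>, which can be
  evaluated on both parts of a decomposition. The Hahn-Banach theorem and the approximation are real
  statements; real and imaginary parts are handled separately, and complex functionals reappear when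
  the rotundity of \<open>B0\<close> is invoked.\<close>

lemma powr_less_imp_less:
  fixes a b p :: real
  assumes "a powr p < b powr p" "0 < p" "0 \<le> b"
  shows "a < b"
  using assms powr_mono2[of p b a] by fastforce

lemma powr_convex_comb:
  fixes a b l p :: real
  assumes "1 \<le> p" "0 \<le> a" "0 \<le> b" "0 \<le> l" "l \<le> 1"
  shows "((1 - l) * a + l * b) powr p \<le> (1 - l) * a powr p + l * b powr p"
proof -
  have le: "t powr p \<le> t" if "0 \<le> t" "t \<le> 1" for t :: real
    using powr_mono'[of 1 p t] that assms(1) by simp
  \<comment> \<open>Only positive endpoints go through \<open>powr_convex\<close>; a vanishing
    endpoint reduces to \<open>t powr p \<le> t\<close> on the unit interval.\<close>
  consider "a = 0" | "b = 0" | "0 < a" "0 < b"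
    using assms by fastforce
  then show ?thesis
  proof cases
    case 1
    then show ?thesis
      using assms le[of l] by (simp add: powr_mult mult_right_mono)
  next
    case 2
    then show ?thesis
      using assms le[of "1 - l"] by (simp add: powr_mult mult_right_mono)
  next
    case 3
    show ?thesis
      using convex_onD[OF powr_convex[OF assms(1)], of l a b] assms 3 by simp
  qed
qed

text \<open>Mean value theorem on the two halves of the interval: they have equal length, and the
  derivative \<open>p * t powr (p - 1)\<close> is strictly larger at the intermediate point of the
  right half.\<close>

lemma powr_midpoint_less:
  fixes a b p :: real
  assumes "1 < p" "0 \<le> a" "a < b"
  shows "((a + b) / 2) powr p < (a powr p + b powr p) / 2"
proof -
  define c where "c = (a + b) / 2"
  have ac: "a < c" "c < b" "0 < c"
    using assms by (auto simp: c_def)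
  have cont: "continuous_on {x..y} (\<lambda>t. t powr p)" if "0 \<le> x" for x y :: real
    using assms that by (intro continuous_on_powr') auto
  have der: "((\<lambda>t. t powr p) has_derivative (\<lambda>d. d * (p * t powr (p - 1)))) (at t)"
    if "0 < t" for t :: real
    using has_real_derivative_powr[OF that, of p] by (simp add: has_field_derivative_def mult_commute_abs)
  obtain z where z: "a < z" "z < c" "c powr p - a powr p = (c - a) * (p * z powr (p - 1))"
    by (rule mvt[OF ac(1) cont[OF assms(2)] der]) (use assms in auto)
  obtain w where w: "c < w" "w < b" "b powr p - c powr p = (b - c) * (p * w powr (p - 1))"
    by (rule mvt[OF ac(2) cont der]) (use ac in auto)
  have bc: "b - c = c - a"
    by (simp add: c_def field_simps)
  have "z powr (p - 1) < w powr (p - 1)"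
    using z w ac assms by (intro powr_less_mono2) auto
  then have "(c - a) * (p * z powr (p - 1)) < (b - c) * (p * w powr (p - 1))"
    unfolding bc using ac assms by (intro mult_strict_left_mono) auto
  then show ?thesis
    using z w by (simp add: c_def field_simps)
qed

lemma powr_add_superadditive:
  fixes a b p :: real
  assumes "1 \<le> p" "0 \<le> a" "0 \<le> b"
  shows "a powr p + b powr p \<le> (a + b) powr p"
proof -
  have eq: "x powr p = x * x powr (p - 1)" if "0 \<le> x" for x :: real
    using that by (simp add: powr_mult_base)
  have "a * a powr (p - 1) \<le> a * (a + b) powr (p - 1)" "b * b powr (p - 1) \<le> b * (a + b) powr (p - 1)"
    using assms by (auto intro!: mult_left_mono powr_mono2)
  then show ?thesis
    using assms by (simp add: eq distrib_right)
qed

lemma powr_add_le: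
  fixes a b p :: real
  assumes "1 \<le> p" "0 \<le> a" "0 \<le> b"
  shows "(a + b) powr p \<le> 2 powr p * (a powr p + b powr p)"
proof -
  have "(a + b) powr p \<le> (2 * max a b) powr p"
    using assms by (intro powr_mono2) auto
  also have "\<dots> = 2 powr p * max a b powr p"
    using assms by (simp add: powr_mult)
  also have "max a b powr p \<le> a powr p + b powr p"
    by (simp add: max_def)
  finally show ?thesis by simp
qed

lemma tendsto_0_of_powr:
  fixes f :: "nat \<Rightarrow> real"
  assumes "(\<lambda>n. f n powr p) \<longlonglongrightarrow> 0" "0 < p" "\<And>n. 0 \<le> f n"
  shows "f \<longlonglongrightarrow> 0"
proof -
  have "(\<lambda>n. (f n powr p) powr (1 / p)) \<longlonglongrightarrow> 0 powr (1 / p)"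
    using assms by (intro tendsto_powr') auto
  then show ?thesis
    using assms by (simp add: powr_powr)
qed

text \<open>Compactness makes strict convexity uniform: on the part \<open>T\<close> of the square
  where the coordinates differ by at least \<open>e\<close>, the continuous gap \<open>F\<close>
  attains a positive minimum, so a gap below that minimum keeps the pair out of
  \<open>T\<close>.\<close>

lemma powr_gap_tendsto_0:
  fixes a b :: "nat \<Rightarrow> real"
  assumes p: "1 < p" and bounds: "\<And>n. 0 \<le> a n \<and> a n \<le> R" "\<And>n. 0 \<le> b n \<and> b n \<le> R"
    and gap: "(\<lambda>n. (a n powr p + b n powr p) / 2 - ((a n + b n) / 2) powr p) \<longlonglongrightarrow> 0"
  shows "(\<lambda>n. a n - b n) \<longlonglongrightarrow> 0"
proof (rule LIMSEQ_I)
  fix e :: real assume "0 < e"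
  define F where "F z = (fst z powr p + snd z powr p) / 2 - ((fst z + snd z) / 2) powr p"
    for z :: "real \<times> real"
  define T where "T = ({0..R} \<times> {0..R}) \<inter> {z::real \<times> real. e \<le> \<bar>fst z - snd z\<bar>}"
  have "compact T"
    unfolding T_def by (intro compact_Int_closed compact_Times closed_Collect_le continuous_intros) auto
  have contF: "continuous_on T F"
    unfolding F_def using p
    by (intro continuous_intros continuous_on_powr') (auto simp: T_def)
  have pos: "0 < F z" if "z \<in> T" for z
    using that powr_midpoint_less[of p "fst z" "snd z"] powr_midpoint_less[of p "snd z" "fst z"] p \<open>0 < e\<close>
    by (cases "fst z < snd z") (auto simp: T_def F_def add.commute)
  show "\<exists>no. \<forall>n\<ge>no. norm (a n - b n - 0) < e"
  proof (cases "T = {}")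
    case True
    then have "(a n, b n) \<notin> T" for n by simp
    then have "\<bar>a n - b n\<bar> < e" for n
      using bounds[of n] unfolding T_def by (force simp: not_le)
    then show ?thesis by simp
  next
    case False
    obtain z where z: "z \<in> T" "\<And>w. w \<in> T \<Longrightarrow> F z \<le> F w"
      using continuous_attains_inf[OF \<open>compact T\<close> False contF] by blast
    have "\<forall>\<^sub>F n in sequentially. F (a n, b n) < F z"
      using order_tendstoD(2)[OF gap pos[OF z(1)]] by (simp add: F_def)
    then have "\<forall>\<^sub>F n in sequentially. \<bar>a n - b n\<bar> < e"
    proof (rule eventually_mono)
      fix n assume "F (a n, b n) < F z"
      then have "(a n, b n) \<notin> T"
        using z(2) by fastforce
      then show "\<bar>a n - b n\<bar> < e"
        using bounds[of n] unfolding T_def by (force simp: not_le)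
    qed
    then show ?thesis
      by (simp add: eventually_sequentially)
  qed
qed

section \<open>Sublinear functionals and the Hahn-Banach theorem\<close>

text \<open>Homogeneity is an inequality because that is what infima deliver; replacing
  \<open>r\<close> by \<open>1 / r\<close> recovers equality for positive \<open>r\<close>. The
  scalar multiplication is a parameter since the real structure arises by restricting a complex
  one.\<close>

definition sublinear_on :: "(real \<Rightarrow> 'v \<Rightarrow> 'v) \<Rightarrow> 'v::ab_group_add set \<Rightarrow> ('v \<Rightarrow> real) \<Rightarrow> bool" where
  "sublinear_on s Y q \<longleftrightarrow> (\<forall>x\<in>Y. \<forall>y\<in>Y. q (x + y) \<le> q x + q y) \<and> (\<forall>r\<ge>0. \<forall>x\<in>Y. q (s r x) \<le> r * q x)"

definition linear_on_set :: "(real \<Rightarrow> 'v \<Rightarrow> 'v) \<Rightarrow> 'v::ab_group_add set \<Rightarrow> ('v \<Rightarrow> real) \<Rightarrow> bool" where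
  "linear_on_set s Y g \<longleftrightarrow> (\<forall>x\<in>Y. \<forall>y\<in>Y. g (x + y) = g x + g y) \<and> (\<forall>r. \<forall>x\<in>Y. g (s r x) = r * g x)"

lemma sublinear_on_zero:
  fixes s :: "real \<Rightarrow> 'v::ab_group_add \<Rightarrow> 'v"
  assumes "vector_space s" "module.subspace s Y" "sublinear_on s Y q"
  shows "q 0 = 0"
proof -
  interpret vector_space s by fact
  have "0 \<in> Y" using assms(2) by (rule subspace_0)
  then have "q (s 0 0) \<le> 0 * q 0" "q (0 + 0) \<le> q 0 + q 0"
    using assms(3) unfolding sublinear_on_def by blast+
  then show ?thesis by simp
qed

lemma linear_on_set_minus:
  fixes s :: "real \<Rightarrow> 'v::ab_group_add \<Rightarrow> 'v"
  assumes "vector_space s" "linear_on_set s Y g" "x \<in> Y"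
  shows "g (- x) = - g x"
proof -
  interpret vector_space s by fact
  have "g (s (- 1) x) = - 1 * g x"
    using assms unfolding linear_on_set_def by blast
  then show ?thesis by (simp add: scale_minus_left)
qed

text \<open>Pushing in a direction \<open>y\<close> produces \<open>h\<close>, the infimum over
  \<open>t \<ge> 0\<close> of \<open>q (z + s t y) - t * q y\<close>, which is sublinear and lies
  below \<open>q\<close>. Minimality gives \<open>h = q\<close>, and the term \<open>t = 1\<close>
  at \<open>x\<close> then reads \<open>q x \<le> q (x + y) - q y\<close>, the missing
  superadditivity.\<close>

lemma sublinear_on_minimal_imp_linear:
  fixes s :: "real \<Rightarrow> 'v::ab_group_add \<Rightarrow> 'v"
  assumes vs: "vector_space s" and Y: "module.subspace s Y" and q: "sublinear_on s Y q"
    and min: "\<And>h. sublinear_on s Y h \<Longrightarrow> (\<And>x. x \<in> Y \<Longrightarrow> h x \<le> q x) \<Longrightarrow> (\<And>x. x \<in> Y \<Longrightarrow> h x = q x)"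
  shows "linear_on_set s Y q"
proof -
  interpret vector_space s by fact
  note clo = subspace_add[OF Y] subspace_scale[OF Y] subspace_0[OF Y] subspace_neg[OF Y]
  have add: "q (x + y) \<le> q x + q y" if "x \<in> Y" "y \<in> Y" for x y
    using q that unfolding sublinear_on_def by blast
  have scl: "q (s r x) \<le> r * q x" if "0 \<le> r" "x \<in> Y" for r x
    using q that unfolding sublinear_on_def by blast
  have q0: "q 0 = 0"
    using sublinear_on_zero[OF vs Y q] .
  have super: "q x + q y \<le> q (x + y)" if x: "x \<in> Y" and y: "y \<in> Y" for x y
  proof -
    define F where "F z t = q (z + s t y) - t * q y" for z t
    define h where "h z = (INF t\<in>{0..}. F z t)" for z
    have bdd: "bdd_below (F z ` {0..})" if "z \<in> Y" for z
    proof (rule bdd_belowI2)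
      fix t :: real assume t: "t \<in> {0..}"
      have "t * q y \<le> q (s t y)"
      proof (cases "t = 0")
        case False
        \<comment> \<open>Scaling back by \<open>1 / t\<close> turns the one-sided homogeneity into
          a lower bound for \<open>q (s t y)\<close>.\<close>
        have "q (s (1 / t) (s t y)) \<le> (1 / t) * q (s t y)"
          using t y by (intro scl clo) auto
        then show ?thesis
          using False t by (simp add: field_simps)
      qed (simp add: q0)
      also have "s t y = (z + s t y) + - z"
        by simp
      also have "q \<dots> \<le> q (z + s t y) + q (- z)"
        using that y by (intro add clo) auto
      finally show "- q (- z) \<le> F z t"
        by (simp add: F_def)
    qed
    have hle: "h z \<le> F z t" if "z \<in> Y" "0 \<le> t" for z t
      unfolding h_def using that by (intro cINF_lower bdd) auto
    have hge: "c \<le> h z" if "\<And>t. 0 \<le> t \<Longrightarrow> c \<le> F z t" for c z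
      unfolding h_def using that by (intro cINF_greatest) auto
    have "sublinear_on s Y h"
      unfolding sublinear_on_def
    proof (intro conjI ballI allI impI)
      fix a b assume ab: "a \<in> Y" "b \<in> Y"
      have "h (a + b) \<le> F a t + F b u" if "0 \<le> t" "0 \<le> u" for t u
      proof -
        have "h (a + b) \<le> F (a + b) (t + u)"
          using that ab by (intro hle clo) auto
        also have "\<dots> = q ((a + s t y) + (b + s u y)) - (t + u) * q y"
          by (simp add: F_def scale_left_distrib algebra_simps)
        also have "\<dots> \<le> F a t + F b u"
          using add[of "a + s t y" "b + s u y"] ab y by (simp add: F_def clo algebra_simps)
        finally show ?thesis .
      qed
      then have "h (a + b) - F b u \<le> h a" if "0 \<le> u" for u
        using that by (intro hge) (simp add: algebra_simps)
      then have "h (a + b) - h a \<le> h b"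
        by (intro hge) (simp add: algebra_simps)
      then show "h (a + b) \<le> h a + h b" by simp
    next
      fix r :: real and a assume r: "0 \<le> r" and a: "a \<in> Y"
      show "h (s r a) \<le> r * h a"
      proof (cases "r = 0")
        case True
        then show ?thesis
          using hle[of 0 0] clo by (simp add: F_def q0)
      next
        case False
        have "h (s r a) / r \<le> F a t" if "0 \<le> t" for t
        proof -
          have "h (s r a) \<le> F (s r a) (r * t)"
            using that r a by (intro hle clo) auto
          also have "\<dots> = q (s r (a + s t y)) - r * t * q y"
            by (simp add: F_def scale_right_distrib)
          also have "\<dots> \<le> r * F a t"
            using scl[of r "a + s t y"] r a y by (simp add: F_def clo algebra_simps)
          finally show ?thesis
            using False r by (simp add: field_simps)
        qed
        then have "h (s r a) / r \<le> h a"
          by (rule hge)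
        then show ?thesis
          using False r by (simp add: field_simps)
      qed
    qed
    moreover have "h z \<le> q z" if "z \<in> Y" for z
      using hle[OF that, of 0] by (simp add: F_def)
    ultimately have "h x = q x"
      using min x by blast
    then show ?thesis
      using hle[OF x, of 1] by (simp add: F_def)
  qed
  have addeq: "q (x + y) = q x + q y" if "x \<in> Y" "y \<in> Y" for x y
    using add[OF that] super[OF that] by simp
  have neg: "q (- x) = - q x" if "x \<in> Y" for x
    using addeq[of x "- x"] that clo q0 by simp
  have "q (s r x) = r * q x" if x: "x \<in> Y" for r x
  proof (cases "0 \<le> r")
    case True
    have "q (- s r x) \<le> r * q (- x)"
      using scl[OF True, of "- x"] x clo by (simp add: scale_minus_right)
    then show ?thesis
      using scl[OF True x] neg[of x] neg[of "s r x"] x clo by simp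
  next
    case False
    then have r: "0 \<le> - r" by simp
    have "q (- s (- r) x) \<le> r * q x" "q (s (- r) x) \<le> - r * q x"
      using scl[OF r, of x] scl[OF r, of "- x"] x clo neg[of x]
      by (simp_all add: scale_minus_right)
    then show ?thesis
      using neg[of "s r x"] x clo by (simp add: scale_minus_left)
  qed
  with addeq show ?thesis
    unfolding linear_on_set_def by blast
qed

text \<open>Zorn's lemma runs downwards through sublinear functionals that live on all of
  \<open>Y\<close>, so domains never change; a minimal one is linear. The pointwise infimum of a
  chain is finite because every member satisfies \<open>h x \<ge> - q (- x)\<close>.\<close>

theorem sublinear_on_dominates_linear:
  fixes s :: "real \<Rightarrow> 'v::ab_group_add \<Rightarrow> 'v"
  assumes vs: "vector_space s" and Y: "module.subspace s Y" and q: "sublinear_on s Y q"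
  obtains g where "linear_on_set s Y g" "\<And>x. x \<in> Y \<Longrightarrow> g x \<le> q x"
proof -
  interpret vector_space s by fact
  note clo = subspace_add[OF Y] subspace_scale[OF Y] subspace_0[OF Y] subspace_neg[OF Y]
  \<comment> \<open>Prescribing the value 0 off \<open>Y\<close> makes the pointwise order antisymmetric.\<close>
  define A where "A = {h. sublinear_on s Y h \<and> (\<forall>x\<in>Y. h x \<le> q x) \<and> (\<forall>x. x \<notin> Y \<longrightarrow> h x = 0)}"
  define q' where "q' x = (if x \<in> Y then q x else 0)" for x
  have q': "q' \<in> A"
    using q unfolding A_def q'_def sublinear_on_def by (auto simp: clo)
  have "\<exists>u\<in>A. \<forall>h\<in>C. u \<le> h" if C: "C \<in> Chains (relation_of (\<lambda>h k. k \<le> h) A)" for C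
  proof (cases "C = {}")
    case True
    then show ?thesis using q' by auto
  next
    case False
    have CA: "h \<in> A" if "h \<in> C" for h
      using C that unfolding Chains_def relation_of_def by auto
    have total: "h \<le> k \<or> k \<le> h" if "h \<in> C" "k \<in> C" for h k
      using C that unfolding Chains_def relation_of_def by auto
    have sub: "h (x + y) \<le> h x + h y" "0 \<le> r \<Longrightarrow> h (s r x) \<le> r * h x" "h x \<le> q x"
      if "h \<in> C" "x \<in> Y" "y \<in> Y" for h x y r
      using CA[OF that(1)] that unfolding A_def sublinear_on_def by auto
    have zero: "h 0 = 0" if "h \<in> C" for h
      using CA[OF that] sublinear_on_zero[OF vs Y] unfolding A_def by auto
    define u where "u x = (if x \<in> Y then INF h\<in>C. h x else 0)" for x
    have bdd: "bdd_below ((\<lambda>h. h x) ` C)" if x: "x \<in> Y" for x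
    proof (rule bdd_belowI2)
      fix h assume h: "h \<in> C"
      show "- q (- x) \<le> h x"
        using sub(1)[OF h x, of "- x"] sub(3)[OF h, of "- x" 0] zero[OF h] x clo by simp
    qed
    have ule: "u x \<le> h x" if "x \<in> Y" "h \<in> C" for x h
      unfolding u_def using that by (auto intro!: cINF_lower bdd)
    have uge: "c \<le> u x" if "x \<in> Y" "\<And>h. h \<in> C \<Longrightarrow> c \<le> h x" for c x
      unfolding u_def using that False by (auto intro!: cINF_greatest)
    have "sublinear_on s Y u"
      unfolding sublinear_on_def
    proof (intro conjI ballI allI impI)
      fix x y assume xy: "x \<in> Y" "y \<in> Y"
      \<comment> \<open>An infimum of sublinear functionals is subadditive only thanks to the chain:
        the smaller of \<open>h\<close> and \<open>k\<close> serves for both arguments.\<close>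
      have "u (x + y) \<le> h x + k y" if hk: "h \<in> C" "k \<in> C" for h k
      proof (cases "h \<le> k")
        case True
        then show ?thesis
          using ule[OF clo(1)[OF xy] hk(1)] sub(1)[OF hk(1) xy] le_funD[OF True, of y] by linarith
      next
        case False
        then have "k \<le> h" using total hk by blast
        then show ?thesis
          using ule[OF clo(1)[OF xy] hk(2)] sub(1)[OF hk(2) xy] le_funD[of k h x] by linarith
      qed
      then have "u (x + y) - k y \<le> u x" if "k \<in> C" for k
        using that xy by (intro uge) (auto simp: algebra_simps)
      then have "u (x + y) - u x \<le> u y"
        using xy by (intro uge) (auto simp: algebra_simps)
      then show "u (x + y) \<le> u x + u y" by simp
    next
      fix r :: real and x assume r: "0 \<le> r" and x: "x \<in> Y"
      have le: "u (s r x) \<le> r * h x" if "h \<in> C" for h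
        using ule[OF clo(2)[OF x] that] sub(2)[OF that x x r] by (rule order_trans)
      show "u (s r x) \<le> r * u x"
      proof (cases "r = 0")
        case True
        obtain h where "h \<in> C" using \<open>C \<noteq> {}\<close> by blast
        then show ?thesis using le[of h] True by simp
      next
        case False
        then have "u (s r x) / r \<le> u x"
          using le r x by (intro uge) (auto simp: field_simps)
        then show ?thesis using False r by (simp add: field_simps)
      qed
    qed
    moreover have "u x \<le> q x" if "x \<in> Y" for x
      using False ule[OF that] sub(3)[OF _ that that] by (metis ex_in_conv order_trans)
    ultimately have "u \<in> A"
      unfolding A_def by (auto simp: u_def)
    moreover have "u \<le> h" if "h \<in> C" for h
      using ule[OF _ that] CA[OF that] by (auto simp: le_fun_def A_def u_def)
    ultimately show ?thesis by blast
  qed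
  moreover have "partial_order_on A (relation_of (\<lambda>h k. k \<le> h) A)"
    by (rule partial_order_on_relation_ofI) auto
  ultimately obtain g where g: "g \<in> A" and gmin: "\<And>h. h \<in> A \<Longrightarrow> h \<le> g \<Longrightarrow> h = g"
    using predicate_Zorn[of A "\<lambda>h k. k \<le> h"] by blast
  have "linear_on_set s Y g"
  proof (rule sublinear_on_minimal_imp_linear[OF vs Y])
    show "sublinear_on s Y g"
      using g by (simp add: A_def)
    fix h x assume h: "sublinear_on s Y h" "\<And>x. x \<in> Y \<Longrightarrow> h x \<le> g x" and x: "x \<in> Y"
    define h' where "h' x = (if x \<in> Y then h x else 0)" for x
    have "sublinear_on s Y h'"
      using h(1) unfolding sublinear_on_def h'_def by (auto simp: clo)
    then have "h' \<in> A"
      using g h(2) unfolding A_def h'_def by force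
    moreover have "h' \<le> g"
      using g h(2) unfolding A_def h'_def le_fun_def by auto
    ultimately have "h' = g" by (rule gmin)
    then show "h x = g x" using x by (metis h'_def)
  qed
  then show ?thesis
    using g that unfolding A_def by blast
qed

definition seminorm_on :: "(real \<Rightarrow> 'v \<Rightarrow> 'v) \<Rightarrow> 'v::ab_group_add set \<Rightarrow> ('v \<Rightarrow> real) \<Rightarrow> bool" where
  "seminorm_on s Y q \<longleftrightarrow>
    (\<forall>x\<in>Y. \<forall>y\<in>Y. q (x + y) \<le> q x + q y) \<and> (\<forall>r. \<forall>x\<in>Y. q (s r x) = \<bar>r\<bar> * q x)"

text \<open>Take a linear minorant of the infimal convolution of \<open>R + m\<close> and \<open>n\<close>.\<close>

lemma linear_on_set_approx_extension:
  fixes s :: "real \<Rightarrow> 'v::ab_group_add \<Rightarrow> 'v"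
  assumes vs: "vector_space s" and W: "module.subspace s W" and Y: "module.subspace s Y"
    and YW: "Y \<subseteq> W" and R: "linear_on_set s Y R" and m: "seminorm_on s Y m"
    and n: "seminorm_on s W n" and bound: "\<And>x. x \<in> Y \<Longrightarrow> \<bar>R x\<bar> \<le> m x + n x"
  obtains g where "linear_on_set s W g" "\<And>x. x \<in> W \<Longrightarrow> \<bar>g x\<bar> \<le> n x"
    "\<And>x. x \<in> Y \<Longrightarrow> \<bar>R x - g x\<bar> \<le> m x"
proof -
  interpret vector_space s by fact
  note cloW = subspace_add[OF W] subspace_scale[OF W] subspace_0[OF W] subspace_neg[OF W] subspace_diff[OF W]
  note cloY = subspace_add[OF Y] subspace_scale[OF Y] subspace_0[OF Y] subspace_neg[OF Y]
  have n_add: "n (x + y) \<le> n x + n y" if "x \<in> W" "y \<in> W" for x y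
    using n that unfolding seminorm_on_def by blast
  have n_scale: "n (s r x) = \<bar>r\<bar> * n x" if "x \<in> W" for x r
    using n that unfolding seminorm_on_def by blast
  have n_neg: "n (- x) = n x" if "x \<in> W" for x
    using n_scale[OF that, of "- 1"] by (simp add: scale_minus_left)
  have m_add: "m (x + y) \<le> m x + m y" if "x \<in> Y" "y \<in> Y" for x y
    using m that unfolding seminorm_on_def by blast
  have m_scale: "m (s r x) = \<bar>r\<bar> * m x" if "x \<in> Y" for x r
    using m that unfolding seminorm_on_def by blast
  have m_neg: "m (- x) = m x" if "x \<in> Y" for x
    using m_scale[OF that, of "- 1"] by (simp add: scale_minus_left)
  have R_add: "R (x + y) = R x + R y" and R_scale: "R (s r x) = r * R x" if "x \<in> Y" "y \<in> Y" for x y r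
    using R that unfolding linear_on_set_def by auto
  have zero: "R 0 = 0" "m 0 = 0" "n 0 = 0"
    using R_scale[OF cloY(3) cloY(3), of 0] m_scale[OF cloY(3), of 0] n_scale[OF cloW(3), of 0] by auto
  define F where "F z x = R x + m x + n (z - x)" for z x
  define q where "q z = (INF x\<in>Y. F z x)" for z
  \<comment> \<open>The hypothesis \<open>bound\<close> gives \<open>R x + m x \<ge> - n x\<close>,
    and the triangle inequality then keeps the infimum above \<open>- n z\<close>.\<close>
  have bdd: "bdd_below (F z ` Y)" if z: "z \<in> W" for z
  proof (rule bdd_belowI2)
    fix x assume x: "x \<in> Y"
    have "n x = n ((x - z) + z)" by simp
    also have "\<dots> \<le> n (x - z) + n z"
      using x z YW by (intro n_add cloW) auto
    also have "n (x - z) = n (z - x)"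
      using n_neg[OF cloW(5), of x z] x z YW by auto
    finally show "- n z \<le> F z x"
      using bound[OF x] unfolding F_def by linarith
  qed
  have qle: "q z \<le> F z x" if "z \<in> W" "x \<in> Y" for z x
    unfolding q_def using that by (intro cINF_lower bdd)
  have qge: "c \<le> q z" if "\<And>x. x \<in> Y \<Longrightarrow> c \<le> F z x" for c z
    unfolding q_def using that cloY(3) by (intro cINF_greatest) auto
  have "sublinear_on s W q"
    unfolding sublinear_on_def
  proof (intro conjI ballI allI impI)
    fix a b assume ab: "a \<in> W" "b \<in> W"
    have "q (a + b) \<le> F a x + F b y" if xy: "x \<in> Y" "y \<in> Y" for x y
    proof -
      have "n ((a - x) + (b - y)) \<le> n (a - x) + n (b - y)"
        using xy ab YW by (intro n_add cloW) auto
      moreover have "(a - x) + (b - y) = a + b - (x + y)" by simp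
      ultimately have "F (a + b) (x + y) \<le> F a x + F b y"
        using m_add[OF xy] R_add[OF xy] unfolding F_def by simp
      then show ?thesis
        using qle[OF cloW(1)[OF ab] cloY(1)[OF xy]] by simp
    qed
    then have "q (a + b) - F b y \<le> q a" if "y \<in> Y" for y
      using that by (intro qge) (simp add: algebra_simps)
    then have "q (a + b) - q a \<le> q b"
      by (intro qge) (simp add: algebra_simps)
    then show "q (a + b) \<le> q a + q b" by simp
  next
    fix r :: real and a assume r: "0 \<le> r" and a: "a \<in> W"
    show "q (s r a) \<le> r * q a"
    proof (cases "r = 0")
      case True
      then show ?thesis
        using qle[of 0 0] cloW cloY by (simp add: F_def zero)
    next
      case False
      have "q (s r a) / r \<le> F a x" if x: "x \<in> Y" for x
      proof -
        have "n (s r a - s r x) = r * n (a - x)"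
          using n_scale[OF cloW(5), of a x r] r a x YW by (auto simp: scale_right_diff_distrib)
        then have "F (s r a) (s r x) = r * F a x"
          using r x by (simp add: F_def R_scale m_scale algebra_simps)
        then show ?thesis
          using qle[OF cloW(2)[OF a] cloY(2)[OF x], of r r] False r by (simp add: field_simps)
      qed
      then have "q (s r a) / r \<le> q a"
        by (rule qge)
      then show ?thesis
        using False r by (simp add: field_simps)
    qed
  qed
  then obtain g where g: "linear_on_set s W g" "\<And>x. x \<in> W \<Longrightarrow> g x \<le> q x"
    using sublinear_on_dominates_linear[OF vs W] by blast
  \<comment> \<open>Two competitors in the infimum: \<open>0\<close> yields
    \<open>g \<le> n\<close>, and the point itself yields \<open>g \<le> R + m\<close> on
    \<open>Y\<close>. Passing to negatives turns both into bounds for absolute values.\<close>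
  have gn: "g x \<le> n x" if "x \<in> W" for x
    using g(2)[OF that] qle[OF that, of 0] cloY(3) by (simp add: F_def zero)
  have gR: "g x \<le> R x + m x" if "x \<in> Y" for x
    using g(2)[of x] qle[of x x] that YW by (force simp: F_def zero)
  have "\<bar>g x\<bar> \<le> n x" if "x \<in> W" for x
    using gn[OF that] gn[OF cloW(4)[OF that]] linear_on_set_minus[OF vs g(1) that] n_neg[OF that]
    by auto
  moreover have "\<bar>R x - g x\<bar> \<le> m x" if x: "x \<in> Y" for x
    using gR[OF x] gR[OF cloY(4)[OF x]] linear_on_set_minus[OF vs g(1), of x]
      linear_on_set_minus[OF vs R x] m_neg[OF x] x YW by auto
  ultimately show ?thesis
    using that g(1) by blast
qed

section \<open>Weak uniform rotundity\<close>

lemma limitin_weak_topologyD: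
  assumes "limitin (weak_topology scl X N) z l F" "f \<in> bounded_functionals scl X N"
  shows "((\<lambda>n. f (z n)) \<longlongrightarrow> f l) F"
proof (rule topological_tendstoI)
  fix U assume U: "open U" "f l \<in> U"
  have "openin (weak_topology scl X N) {x \<in> X. f x \<in> U}"
    unfolding weak_topology_def using assms(2) U by (intro topology_generated_by_Basis) auto
  moreover have "l \<in> X"
    using assms(1) by (auto simp: limitin_def weak_topology_def)
  ultimately have "\<forall>\<^sub>F n in F. z n \<in> {x \<in> X. f x \<in> U}"
    using assms(1) U unfolding limitin_def by blast
  then show "\<forall>\<^sub>F n in F. f (z n) \<in> U"
    by (rule eventually_mono) simp
qed

lemma limitin_weak_topologyI:
  assumes l: "l \<in> X" and z: "\<And>n. z n \<in> X"
    and lim: "\<And>f. f \<in> bounded_functionals scl X N \<Longrightarrow> ((\<lambda>n. f (z n)) \<longlongrightarrow> f l) F"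
  shows "limitin (weak_topology scl X N) z l F"
proof -
  define B where "B = {{x \<in> X. f x \<in> U} |f U. f \<in> bounded_functionals scl X N \<and> open U}"
  \<comment> \<open>The zero functional makes \<open>X\<close> a subbasic set, so the topological
    space contains all of \<open>X\<close>.\<close>
  have "X \<in> B"
  proof -
    have "(\<lambda>_. 0) \<in> bounded_functionals scl X N"
      unfolding bounded_functionals_def mem_Collect_eq
      by (intro conjI exI[of _ 0]) simp_all
    then have "{x \<in> X. (\<lambda>_. 0::complex) x \<in> UNIV} \<in> B"
      unfolding B_def mem_Collect_eq
      by (intro exI[of _ "\<lambda>_. 0"] exI[of _ UNIV] conjI) simp_all
    then show ?thesis by simp
  qed
  have "\<forall>\<^sub>F n in F. z n \<in> U" if "generate_topology_on B U" "l \<in> U" for U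
    using that
  proof (induction rule: generate_topology_on.induct)
    case (Basis s)
    then obtain f V where f: "f \<in> bounded_functionals scl X N" "open V" "s = {x \<in> X. f x \<in> V}"
      unfolding B_def by auto
    have "\<forall>\<^sub>F n in F. f (z n) \<in> V"
      using topological_tendstoD[OF lim[OF f(1)] f(2)] Basis(2) f(3) by simp
    then show ?case
      by (rule eventually_mono) (use f(3) z in simp)
  next
    case (UN K)
    then obtain k where k: "k \<in> K" "l \<in> k" by blast
    show ?case
      by (rule eventually_mono[OF UN.IH[OF k]]) (use k in auto)
  next
    case (Int a b)
    then show ?case by (simp add: eventually_conj_iff)
  qed simp
  then show ?thesis
    unfolding limitin_def weak_topology_def B_def[symmetric] openin_topology_generated_by_iff
      topology_generated_by_topspace using UnionI[OF \<open>X \<in> B\<close> l] by simp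
qed

section \<open>Real functionals and homogeneous convex functions\<close>

lemma real_vector_space:
  assumes "vector_space (scl :: complex \<Rightarrow> 'v::ab_group_add \<Rightarrow> 'v)"
  shows "vector_space (\<lambda>r. scl (complex_of_real r))"
proof -
  interpret vector_space scl by fact
  show ?thesis
    by unfold_locales (simp_all add: scale_left_distrib scale_right_distrib)
qed

lemma real_subspace:
  assumes "vector_space (scl :: complex \<Rightarrow> 'v::ab_group_add \<Rightarrow> 'v)" "module.subspace scl X"
  shows "module.subspace (\<lambda>r. scl (complex_of_real r)) X"
proof -
  interpret vector_space scl by fact
  interpret R: vector_space "\<lambda>r. scl (complex_of_real r)"
    by (rule real_vector_space) fact
  show ?thesis
    using assms(2) by (simp add: R.subspace_def subspace_def)
qed

text \<open>The usual passage from a real functional \<open>R\<close> to the complex linear one with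
  real part \<open>R\<close>. It lets functionals from the real Hahn-Banach theorem act as test
  functionals for the weak topology.\<close>

lemma real_functional_complexify:
  assumes vs: "vector_space (scl :: complex \<Rightarrow> 'v::ab_group_add \<Rightarrow> 'v)"
    and X: "module.subspace scl X"
    and R: "linear_on_set (\<lambda>r. scl (complex_of_real r)) X R"
    and bound: "\<And>x. x \<in> X \<Longrightarrow> \<bar>R x\<bar> \<le> M * N x"
    and scale: "\<And>x. x \<in> X \<Longrightarrow> N (scl \<i> x) = N x"
  shows "(\<lambda>x. Complex (R x) (- R (scl \<i> x))) \<in> bounded_functionals scl X N"
proof -
  interpret vector_space scl by fact
  note clo = subspace_add[OF X] subspace_scale[OF X]
  have add: "R (x + y) = R x + R y" if "x \<in> X" "y \<in> X" for x y
    using R that unfolding linear_on_set_def by blast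
  have sc: "R (scl (of_real r) x) = r * R x" if "x \<in> X" for r x
    using R that unfolding linear_on_set_def by blast
  have cpl: "R (scl c x) = Re c * R x + Im c * R (scl \<i> x)" if x: "x \<in> X" for c x
  proof -
    have "scl c x = scl (of_real (Re c)) x + scl (of_real (Im c)) (scl \<i> x)"
      by (simp add: scale_left_distrib[symmetric] complex_eq_iff)
    then show ?thesis
      using x sc[OF clo(2)[OF x], of "Im c" \<i>] by (simp only: add sc clo)
  qed
  have bd: "cmod (Complex (R x) (- R (scl \<i> x))) \<le> (2 * M) * N x" if x: "x \<in> X" for x
    using cmod_le[of "Complex (R x) (- R (scl \<i> x))"] bound[OF x] bound[OF clo(2)[OF x], of \<i>]
      scale[OF x] by simp
  show ?thesis
    unfolding bounded_functionals_def mem_Collect_eq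
  proof (intro conjI ballI allI exI)
    fix x y assume "x \<in> X" "y \<in> X"
    then show "Complex (R (x + y)) (- R (scl \<i> (x + y))) =
        Complex (R x) (- R (scl \<i> x)) + Complex (R y) (- R (scl \<i> y))"
      by (simp add: add clo scale_right_distrib complex_eq_iff)
  next
    fix c x assume x: "x \<in> X"
    show "Complex (R (scl c x)) (- R (scl \<i> (scl c x))) = c * Complex (R x) (- R (scl \<i> x))"
      using cpl[OF x, of c] cpl[OF x, of "\<i> * c"] by (simp add: complex_eq_iff)
  qed (rule bd)
qed

text \<open>Minkowski functional argument: for \<open>a\<close>, \<open>b\<close> slightly above the
  p-th roots, \<open>s (1 / a) x\<close> and \<open>s (1 / b) y\<close> lie in the convex set
  \<open>Q \<le> 1\<close>, and \<open>s (1 / (a + b)) (x + y)\<close> is their convex combination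
  with weight \<open>l = b / (a + b)\<close>. It serves each \<open>\<Psi> n\<close> as well as
  their sum \<open>\<Phi>\<close>.\<close>

lemma homogeneous_convex_powr_triangle:
  fixes s :: "real \<Rightarrow> 'v::ab_group_add \<Rightarrow> 'v"
  assumes vs: "vector_space s" and Y: "module.subspace s Y" and p: "0 < p"
    and nonneg: "\<And>x. x \<in> Y \<Longrightarrow> 0 \<le> Q x"
    and scale: "\<And>r x. 0 < r \<Longrightarrow> x \<in> Y \<Longrightarrow> Q (s r x) = r powr p * Q x"
    and conv: "\<And>l x y. 0 \<le> l \<Longrightarrow> l \<le> 1 \<Longrightarrow> x \<in> Y \<Longrightarrow> y \<in> Y \<Longrightarrow>
      Q (s (1 - l) x + s l y) \<le> (1 - l) * Q x + l * Q y"
    and x: "x \<in> Y" and y: "y \<in> Y"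
  shows "Q (x + y) powr (1 / p) \<le> Q x powr (1 / p) + Q y powr (1 / p)"
proof (rule field_le_epsilon)
  interpret vector_space s by fact
  note clo = subspace_add[OF Y] subspace_scale[OF Y]
  fix e :: real assume e: "0 < e"
  \<comment> \<open>The extra \<open>e / 2\<close> keeps both denominators positive where
    \<open>Q\<close> vanishes.\<close>
  define a b where "a = Q x powr (1 / p) + e / 2" and "b = Q y powr (1 / p) + e / 2"
  have pos: "0 < a" "0 < b"
    using e by (auto simp: a_def b_def add_nonneg_pos)
  have one: "Q (s (1 / c) z) \<le> 1" if "Q z powr (1 / p) \<le> c" "0 < c" "z \<in> Y" for c z
  proof -
    have "Q z = (Q z powr (1 / p)) powr p"
      using p nonneg[OF that(3)] by (simp add: powr_powr)
    also have "\<dots> \<le> c powr p"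
      using p that by (intro powr_mono2) auto
    finally show ?thesis
      using that by (simp add: scale powr_divide field_simps)
  qed
  have "Q (s (1 / (a + b)) (x + y)) \<le> 1"
  proof -
    define l where "l = b / (a + b)"
    have l: "0 \<le> l" "l \<le> 1" "1 - l = a / (a + b)"
      using pos by (auto simp: l_def field_simps)
    have "s (1 / (a + b)) (x + y) = s (1 - l) (s (1 / a) x) + s l (s (1 / b) y)"
      using pos unfolding l(3) by (simp add: l_def scale_right_distrib)
    also have "Q \<dots> \<le> (1 - l) * Q (s (1 / a) x) + l * Q (s (1 / b) y)"
      using x y l by (intro conv clo) auto
    also have "\<dots> \<le> (1 - l) * 1 + l * 1"
      using pos x y l e by (intro add_mono mult_left_mono one) (auto simp: a_def b_def)
    finally show ?thesis by simp
  qed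
  then have "Q (x + y) \<le> (a + b) powr p"
    using pos scale[of "1 / (a + b)" "x + y"] clo(1)[OF x y]
    by (simp add: powr_divide divide_le_eq_1)
  then have "Q (x + y) powr (1 / p) \<le> ((a + b) powr p) powr (1 / p)"
    using p x y by (intro powr_mono2 nonneg clo) auto
  also have "\<dots> = a + b"
    using p pos by (simp add: powr_powr)
  finally show "Q (x + y) powr (1 / p) \<le> Q x powr (1 / p) + Q y powr (1 / p) + e"
    by (simp add: a_def b_def)
qed

section \<open>Normed and Banach spaces given by a carrier\<close>

context complex_normed_space
begin

lemma carrier_closed:
  "0 \<in> X" "x \<in> X \<Longrightarrow> y \<in> X \<Longrightarrow> x + y \<in> X" "x \<in> X \<Longrightarrow> y \<in> X \<Longrightarrow> x - y \<in> X"
  "x \<in> X \<Longrightarrow> scl c x \<in> X" "x \<in> X \<Longrightarrow> - x \<in> X"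
  using subspace_carrier subspace_0 subspace_add subspace_diff subspace_scale subspace_neg by auto

lemma norm_zero: "N 0 = 0"
  using norm_eq_0_iff carrier_closed(1) by blast

lemma norm_minus: "x \<in> X \<Longrightarrow> N (- x) = N x"
  using norm_scale[of x "- 1"] by (simp add: scale_minus_left)

lemma norm_minus_commute: "x \<in> X \<Longrightarrow> y \<in> X \<Longrightarrow> N (x - y) = N (y - x)"
  using norm_minus[of "x - y"] carrier_closed by simp

lemma norm_triangle_diff: "x \<in> X \<Longrightarrow> y \<in> X \<Longrightarrow> N (x - y) \<le> N x + N y"
  using norm_triangle[of x "- y"] carrier_closed(5) norm_minus by simp

lemma norm_sum_le:
  assumes "\<And>i. i \<in> I \<Longrightarrow> d i \<in> X"
  shows "N (\<Sum>i\<in>I. d i) \<le> (\<Sum>i\<in>I. N (d i))"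
  using assms
proof (induction I rule: infinite_finite_induct)
  case (insert i I)
  then have "(\<Sum>i\<in>I. d i) \<in> X"
    by (intro subspace_sum subspace_carrier) auto
  then show ?case
    using insert norm_triangle[of "d i" "\<Sum>i\<in>I. d i"] by force
qed (auto simp: norm_zero)

lemma norm_limitin_iff:
  assumes "\<And>n. z n \<in> X" "l \<in> X"
  shows "limitin norm.mtopology z l sequentially \<longleftrightarrow> (\<lambda>n. N (z n - l)) \<longlonglongrightarrow> 0"
  using assms norm_nonneg[OF carrier_closed(3)[OF assms]]
  by (simp add: norm.limitin_metric norm_dist_def tendsto_iff dist_real_def)

end

text \<open>The partial sums are Cauchy because the real series of norms dominates their
  differences. Geometric bounds suffice: the increments of a fast Cauchy subsequence in
  \<open>B0 + B1\<close> split into parts that obey them.\<close>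

lemma (in complex_Banach_space) geometric_series_converges:
  assumes d: "\<And>i. d i \<in> X" and bound: "\<And>i. N (d i) \<le> C * (1 / 2) ^ i"
  shows "\<exists>l\<in>X. (\<lambda>k. N ((\<Sum>i<k. d i) - l)) \<longlonglongrightarrow> 0"
proof -
  define D where "D k = (\<Sum>i<k. d i)" for k
  have D: "D k \<in> X" for k
    unfolding D_def using d by (intro subspace_sum subspace_carrier) auto
  have summ: "summable (\<lambda>i. N (d i))"
    by (rule summable_comparison_test'[where g = "\<lambda>i. C * (1 / 2) ^ i" and N = 0])
      (use bound norm_nonneg d in \<open>auto intro!: summable_mult summable_geometric\<close>)
  define T where "T k = (\<Sum>i<k. N (d i))" for k
  have diff: "N (D n - D m) \<le> \<bar>T n - T m\<bar>" for m n
  proof -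
    have *: "N (D n - D m) \<le> T n - T m" if "m \<le> n" for m n
    proof -
      have "D n - D m = (\<Sum>i\<in>{m..<n}. d i)" "T n - T m = (\<Sum>i\<in>{m..<n}. N (d i))"
        unfolding D_def T_def lessThan_atLeast0 using that by (simp_all add: sum_diff_nat_ivl)
      then show ?thesis
        using norm_sum_le[of "{m..<n}" d] d by simp
    qed
    show ?thesis
      using *[of m n] *[of n m] norm_minus_commute[OF D D, of n m] by (cases "m \<le> n") auto
  qed
  have "convergent T"
    using summ unfolding T_def summable_iff_convergent .
  then have "Cauchy T"
    by (rule convergent_Cauchy)
  have "norm.MCauchy D"
    unfolding norm.MCauchy_def
  proof (intro conjI allI impI)
    fix e :: real assume "0 < e"
    then obtain M where M: "\<And>m n. m \<ge> M \<Longrightarrow> n \<ge> M \<Longrightarrow> \<bar>T m - T n\<bar> < e"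
      using \<open>Cauchy T\<close> unfolding Cauchy_def dist_real_def by blast
    show "\<exists>M. \<forall>n n'. M \<le> n \<longrightarrow> M \<le> n' \<longrightarrow> norm_dist (D n) (D n') < e"
    proof (intro exI allI impI)
      fix n n' assume "M \<le> n" "M \<le> n'"
      then show "norm_dist (D n) (D n') < e"
        using M[of n n'] diff[of n n'] D by (simp add: norm_dist_def)
    qed
  qed (use D in auto)
  then obtain l where l: "limitin norm.mtopology D l sequentially"
    using complete unfolding norm.mcomplete_def by blast
  then have "l \<in> X"
    by (simp add: norm.limitin_metric)
  then show ?thesis
    using l norm_limitin_iff[of D l] D unfolding D_def[abs_def] by blast
qed

text \<open>Counterexamples for \<open>d = inverse (Suc n)\<close> would form two sequences
  violating the definition. This form, for one fixed functional, is needed because vectors will be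
  normalised only at those indices where they are not short.\<close>

lemma weakly_uniformly_rotund_modulus:
  assumes wur: "weakly_uniformly_rotund scl X N" and f: "f \<in> bounded_functionals scl X N"
    and e: "0 < e"
  shows "\<exists>d>0. \<forall>x\<in>X. \<forall>y\<in>X. N x = 1 \<longrightarrow> N y = 1 \<longrightarrow> 2 - d < N (x + y) \<longrightarrow> cmod (f (x - y)) < e"
proof (rule ccontr)
  interpret complex_Banach_space scl X N
    using wur by (simp add: weakly_uniformly_rotund_def)
  assume contra: "\<not> ?thesis"
  have "\<exists>x y. x \<in> X \<and> y \<in> X \<and> N x = 1 \<and> N y = 1 \<and> 2 - d < N (x + y) \<and> e \<le> cmod (f (x - y))"
    if "0 < d" for d
    using contra that unfolding not_less[symmetric] by blast
  then have "\<forall>n::nat. \<exists>x y. x \<in> X \<and> y \<in> X \<and> N x = 1 \<and> N y = 1 \<and>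
      2 - inverse (real (Suc n)) < N (x + y) \<and> e \<le> cmod (f (x - y))"
    by simp
  then obtain x y where xy: "\<And>n. x n \<in> X" "\<And>n. y n \<in> X" "\<And>n. N (x n) = 1" "\<And>n. N (y n) = 1"
    "\<And>n. 2 - inverse (real (Suc n)) < N (x n + y n)" "\<And>n. e \<le> cmod (f (x n - y n))"
    by metis
  have "(\<lambda>n. N (x n + y n)) \<longlonglongrightarrow> 2"
  proof (rule tendsto_sandwich)
    show "\<forall>\<^sub>F n in sequentially. 2 - inverse (real (Suc n)) \<le> N (x n + y n)"
      using xy(5) by (simp add: less_imp_le)
    show "\<forall>\<^sub>F n in sequentially. N (x n + y n) \<le> 2"
      using norm_triangle[OF xy(1,2)] xy(3,4) by simp
    show "(\<lambda>n. 2 - inverse (real (Suc n))) \<longlonglongrightarrow> 2"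
      using tendsto_diff[OF tendsto_const LIMSEQ_inverse_real_of_nat, of "2::real"] by simp
  qed simp
  then have "limitin (weak_topology scl X N) (\<lambda>n. x n - y n) 0 sequentially"
    using wur xy unfolding weakly_uniformly_rotund_def by blast
  from limitin_weak_topologyD[OF this f] have "(\<lambda>n. f (x n - y n)) \<longlonglongrightarrow> f 0" .
  moreover have "f 0 = 0"
  proof -
    have "f (0 + 0) = f 0 + f 0"
      using f carrier_closed(1) unfolding bounded_functionals_def by blast
    then show ?thesis by simp
  qed
  ultimately have "(\<lambda>n. cmod (f (x n - y n))) \<longlonglongrightarrow> 0"
    using tendsto_norm_zero by metis
  then have "e \<le> 0"
    by (rule LIMSEQ_le_const) (use xy(6) in blast)
  with e show False by simp
qed

text \<open>The gap dominates two nonnegative quantities: the convexity gap of the lengths, so the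
  lengths approach each other, and a power of half the defect in the triangle inequality, so that
  this defect vanishes in the limit. On short vectors \<open>f\<close> is small by boundedness; the
  others are normalised and fall under the modulus.\<close>

lemma weakly_uniformly_rotund_powr_gap:
  assumes wur: "weakly_uniformly_rotund scl X N" and f: "f \<in> bounded_functionals scl X N"
    and p: "1 < p" and u: "\<And>n. u n \<in> X" "\<And>n. N (u n) \<le> B" and v: "\<And>n. v n \<in> X" "\<And>n. N (v n) \<le> B"
    and gap: "(\<lambda>n. (N (u n) powr p + N (v n) powr p) / 2 - (N (u n + v n) / 2) powr p) \<longlonglongrightarrow> 0"
  shows "(\<lambda>n. f (u n - v n)) \<longlonglongrightarrow> 0"
proof -
  interpret complex_Banach_space scl X N
    using wur by (simp add: weakly_uniformly_rotund_def)
  define a b c where "a n = N (u n)" and "b n = N (v n)" and "c n = N (u n + v n)" for n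
  have nn: "0 \<le> a n" "0 \<le> b n" "0 \<le> c n" "a n \<le> B" "b n \<le> B" "c n \<le> a n + b n" for n
    unfolding a_def b_def c_def using u v by (auto intro!: norm_nonneg norm_triangle carrier_closed)
  have mid: "(c n / 2) powr p \<le> ((a n + b n) / 2) powr p" for n
    using nn[of n] p by (intro powr_mono2) auto
  have cvx: "((a n + b n) / 2) powr p \<le> (a n powr p + b n powr p) / 2" for n
    using powr_convex_comb[of p "a n" "b n" "1 / 2"] nn[of n] p by (simp add: add_divide_distrib)
  have gap': "(\<lambda>n. (a n powr p + b n powr p) / 2 - (c n / 2) powr p) \<longlonglongrightarrow> 0"
    using gap by (simp add: a_def b_def c_def)
  have "(\<lambda>n. (a n powr p + b n powr p) / 2 - ((a n + b n) / 2) powr p) \<longlonglongrightarrow> 0"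
    by (rule tendsto_sandwich[OF _ _ tendsto_const gap'])
      (use mid cvx in \<open>auto intro!: always_eventually diff_left_mono\<close>)
  then have ab: "(\<lambda>n. a n - b n) \<longlonglongrightarrow> 0"
    by (rule powr_gap_tendsto_0[OF p, rotated 2]) (use nn in auto)
  have "(\<lambda>n. ((a n + b n - c n) / 2) powr p) \<longlonglongrightarrow> 0"
  proof (rule tendsto_sandwich[OF _ _ tendsto_const gap'])
    \<comment> \<open>Superadditivity applies since \<open>(a n + b n - c n) / 2\<close> and
      \<open>c n / 2\<close> add up to the mean length.\<close>
    have "((a n + b n - c n) / 2) powr p \<le> (a n powr p + b n powr p) / 2 - (c n / 2) powr p" for n
      using powr_add_superadditive[of p "(a n + b n - c n) / 2" "c n / 2"] nn[of n] p cvx[of n]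
      by (simp add: field_simps)
    then show "\<forall>\<^sub>F n in sequentially. ((a n + b n - c n) / 2) powr p \<le>
        (a n powr p + b n powr p) / 2 - (c n / 2) powr p"
      by simp
  qed simp
  then have "(\<lambda>n. (a n + b n - c n) / 2) \<longlonglongrightarrow> 0"
    by (rule tendsto_0_of_powr) (use p nn in \<open>auto simp: field_simps\<close>)
  then have abc: "(\<lambda>n. a n + b n - c n) \<longlonglongrightarrow> 0"
    using tendsto_mult_right_zero[of _ _ "2::real"] by fastforce
  obtain M0 where "\<And>x. x \<in> X \<Longrightarrow> cmod (f x) \<le> M0 * N x"
    using f unfolding bounded_functionals_def by blast
  moreover define M where "M = max M0 1"
  ultimately have M: "\<And>x. x \<in> X \<Longrightarrow> cmod (f x) \<le> M * N x" "0 < M"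
    using norm_nonneg by (force intro: order_trans mult_right_mono)+
  have f_add: "f (x + y) = f x + f y" and f_scale: "f (scl z x) = z * f x"
    if "x \<in> X" "y \<in> X" for x y z
    using f that unfolding bounded_functionals_def by blast+
  show ?thesis
  proof (rule tendstoI, unfold dist_complex_def diff_0_right)
    fix e :: real assume e: "0 < e"
    have B: "0 \<le> B" using nn(1,4)[of 0] by linarith
    \<comment> \<open>Threshold for short vectors: below it \<open>M * (a n + b n)\<close> stays
      under \<open>4 * M * r = e\<close>.\<close>
    define r where "r = e / (4 * M)"
    have r: "0 < r" using e M by (simp add: r_def)
    define e' where "e' = e / (2 * (B + 1))"
    have e': "0 < e'" using e B by (simp add: e'_def)
    obtain d where d: "0 < d" "\<And>x y. x \<in> X \<Longrightarrow> y \<in> X \<Longrightarrow> N x = 1 \<Longrightarrow> N y = 1 \<Longrightarrow> 2 - d < N (x + y) \<Longrightarrow>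
        cmod (f (x - y)) < e'"
      using weakly_uniformly_rotund_modulus[OF wur f e'] by blast
    \<comment> \<open>The bound \<open>r / 2\<close> keeps \<open>b n\<close> positive whenever
      \<open>a n \<ge> r\<close>; the bound \<open>d * r / 4\<close> gives
      \<open>3 * h < d * a n\<close>, where \<open>3 * h\<close> is the total loss in passing from
      \<open>u n\<close>, \<open>v n\<close> to unit vectors.\<close>
    define h where "h = min (r / 2) (d * r / 4)"
    have h: "0 < h" using r d by (simp add: h_def)
    have ev1: "\<forall>\<^sub>F n in sequentially. \<bar>a n - b n\<bar> < h"
      using tendstoD[OF ab h] by (simp add: dist_real_def)
    have ev2: "\<forall>\<^sub>F n in sequentially. \<bar>a n + b n - c n\<bar> < h"
      using tendstoD[OF abc h] by (simp add: dist_real_def)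
    show "\<forall>\<^sub>F n in sequentially. cmod (f (u n - v n)) < e"
      using ev1 ev2
    proof eventually_elim
      case (elim n)
      show ?case
      proof (cases "a n < r")
        case True
        have "cmod (f (u n - v n)) \<le> M * N (u n - v n)"
          using u v by (intro M carrier_closed) auto
        also have "\<dots> \<le> M * (a n + b n)"
          unfolding a_def b_def using u v M by (intro mult_left_mono norm_triangle_diff) auto
        also have "\<dots> < M * (4 * r)"
          using M True elim(1) r unfolding h_def by (intro mult_strict_left_mono) linarith+
        also have "\<dots> = e" using M by (simp add: r_def)
        finally show ?thesis .
      next
        case False
        then have pos: "0 < a n" "0 < b n" using r elim(1) unfolding h_def by linarith+
        define x y where "x = scl (of_real (1 / a n)) (u n)" and "y = scl (of_real (1 / b n)) (v n)"
        have xy: "x \<in> X" "y \<in> X" "N x = 1" "N y = 1"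
          using u v pos unfolding x_def y_def a_def b_def
          by (auto simp: norm_scale norm_of_real norm_divide intro!: carrier_closed)
        have eq: "u n = scl (of_real (a n)) x" "v n = scl (of_real (b n)) y"
          using pos by (simp_all add: x_def y_def flip: of_real_mult)
        \<comment> \<open>Both directions receive the common coefficient \<open>a n\<close>; the
          difference of the lengths is charged to \<open>y\<close>.\<close>
        have "u n + v n = scl (of_real (a n)) (x + y) + scl (of_real (b n - a n)) y"
          unfolding eq by (simp add: scale_right_distrib scale_left_diff_distrib)
        then have "c n \<le> N (scl (of_real (a n)) (x + y)) + N (scl (of_real (b n - a n)) y)"
          unfolding c_def using xy by (simp only:) (intro norm_triangle carrier_closed, auto)
        also have "\<dots> = a n * N (x + y) + \<bar>b n - a n\<bar>"
          using xy pos by (simp only: norm_scale carrier_closed norm_of_real) simp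
        finally have "2 * a n - 3 * h < a n * N (x + y)"
          using elim by linarith
        moreover have "3 * h < d * a n"
        proof -
          have "3 * h \<le> 3 * (d * r / 4)" by (simp add: h_def)
          also have "\<dots> < d * r" using d r by simp
          also have "\<dots> \<le> d * a n" using False d by (intro mult_left_mono) auto
          finally show ?thesis .
        qed
        ultimately have "a n * (2 - d) < a n * N (x + y)"
          by (simp add: algebra_simps)
        then have "2 - d < N (x + y)" using pos by simp
        then have fe: "cmod (f (x - y)) < e'" using d xy by blast
        have "u n - v n = scl (of_real (a n)) (x - y) + scl (of_real (a n - b n)) y"
          unfolding eq by (simp add: scale_right_diff_distrib scale_left_diff_distrib)
        then have "f (u n - v n) = of_real (a n) * f (x - y) + of_real (a n - b n) * f y"
          using xy by (simp only: f_add f_scale carrier_closed)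
        then have "cmod (f (u n - v n)) \<le> a n * cmod (f (x - y)) + \<bar>a n - b n\<bar> * cmod (f y)"
          using pos norm_triangle_ineq[of "of_real (a n) * f (x - y)" "of_real (a n - b n) * f y"]
          by (simp only: norm_mult norm_of_real abs_of_pos)
        also have "\<dots> \<le> B * e' + (r / 2) * M"
          using M(1)[OF xy(2)] xy nn[of n] fe elim(1) e' B r by (intro add_mono mult_mono) (auto simp: h_def)
        also have "\<dots> < e"
        proof -
          have "B * e' < e / 2"
            using B e by (simp add: e'_def field_simps)
          moreover have "(r / 2) * M < e / 2"
            using M e by (simp add: r_def field_simps)
          ultimately show ?thesis by linarith
        qed
        finally show ?thesis .
      qed
    qed
  qed
qed

section \<open>Sums of two Banach spaces\<close>

text \<open>The weights stay abstract: their positivity carries the Banach space theory, and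
  rotundity asks in addition that \<open>\<beta>\<close> be unbounded. Dyadic weights enter with the
  K-functional.\<close>

locale weighted_couple = interpolation_couple scl B0 N0 B1 N1
  for scl :: "complex \<Rightarrow> 'v::{topological_ab_group_add, t2_space} \<Rightarrow> 'v"
    and B0 :: "'v set" and N0 :: "'v \<Rightarrow> real" and B1 :: "'v set" and N1 :: "'v \<Rightarrow> real" +
  fixes \<alpha> \<beta> :: "nat \<Rightarrow> real" and p :: real
  assumes weight_pos: "0 < \<alpha> n" "0 < \<beta> n" and p_gt_1: "1 < p"
begin

definition cost :: "nat \<Rightarrow> 'v \<Rightarrow> 'v \<Rightarrow> real" where
  "cost n a b = (\<alpha> n * N0 a) powr p + (\<beta> n * N1 b) powr p"

definition sum_space :: "'v set" where
  "sum_space = {a + b |a b. a \<in> B0 \<and> b \<in> B1}"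

definition \<Psi> :: "nat \<Rightarrow> 'v \<Rightarrow> real" where
  "\<Psi> n x = Inf {cost n a b |a b. a \<in> B0 \<and> b \<in> B1 \<and> x = a + b}"

text \<open>Index 0 is an arbitrary representative; \<open>\<Psi>_le_\<Psi>_0\<close> bounds every
  other \<open>\<Psi> n\<close> by a multiple of this one.\<close>

definition sum_norm :: "'v \<Rightarrow> real" where
  "sum_norm x = \<Psi> 0 x powr (1 / p)"

abbreviation rscale :: "real \<Rightarrow> 'v \<Rightarrow> 'v" where
  "rscale r \<equiv> scl (complex_of_real r)"

lemma p_pos: "0 < p" and p_ge_1: "1 \<le> p"
  using p_gt_1 by auto

lemma vs: "vector_space scl"
  by (rule B0.vector_space_axioms)

lemma real_vs: "vector_space rscale"
  by (rule real_vector_space[OF vs])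

lemma sum_space_subspace: "B0.subspace sum_space"
  unfolding sum_space_def
  by (rule B0.subspace_sums[OF B0.subspace_carrier B1.subspace_carrier])

lemma sum_spaceI: "a \<in> B0 \<Longrightarrow> b \<in> B1 \<Longrightarrow> a + b \<in> sum_space"
  unfolding sum_space_def by blast

lemma sum_space_closed:
  "0 \<in> sum_space" "x \<in> sum_space \<Longrightarrow> y \<in> sum_space \<Longrightarrow> x + y \<in> sum_space"
  "x \<in> sum_space \<Longrightarrow> y \<in> sum_space \<Longrightarrow> x - y \<in> sum_space"
  "x \<in> sum_space \<Longrightarrow> scl c x \<in> sum_space" "x \<in> sum_space \<Longrightarrow> - x \<in> sum_space"
  using sum_space_subspace B0.subspace_0 B0.subspace_add B0.subspace_diff B0.subspace_scale
    B0.subspace_neg by auto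

lemma cost_nonneg: "0 \<le> cost n a b"
  by (simp add: cost_def)

lemma \<Psi>_le: "a \<in> B0 \<Longrightarrow> b \<in> B1 \<Longrightarrow> \<Psi> n (a + b) \<le> cost n a b"
  unfolding \<Psi>_def by (intro cInf_lower bdd_belowI[of _ 0]) (auto simp: cost_nonneg)

lemma \<Psi>_greatest:
  assumes "x \<in> sum_space" "\<And>a b. a \<in> B0 \<Longrightarrow> b \<in> B1 \<Longrightarrow> x = a + b \<Longrightarrow> c \<le> cost n a b"
  shows "c \<le> \<Psi> n x"
  unfolding \<Psi>_def using assms by (intro cInf_greatest) (auto simp: sum_space_def)

lemma \<Psi>_nonneg: "x \<in> sum_space \<Longrightarrow> 0 \<le> \<Psi> n x"
  by (rule \<Psi>_greatest) (auto simp: cost_nonneg)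

lemma \<Psi>_approx:
  assumes "x \<in> sum_space" "\<Psi> n x < e"
  obtains a b where "a \<in> B0" "b \<in> B1" "x = a + b" "cost n a b < e"
proof -
  have "\<exists>a b. a \<in> B0 \<and> b \<in> B1 \<and> x = a + b \<and> cost n a b < e"
    using \<Psi>_greatest[OF assms(1), of e n] assms(2) by (meson not_le)
  then show ?thesis using that by blast
qed

lemma cost_convex:
  assumes a: "a \<in> B0" "a' \<in> B0" and b: "b \<in> B1" "b' \<in> B1" and l: "0 \<le> l" "l \<le> 1"
  shows "cost n (rscale (1 - l) a + rscale l a') (rscale (1 - l) b + rscale l b')
    \<le> (1 - l) * cost n a b + l * cost n a' b'"
proof -
  have "(\<alpha> n * N0 (rscale (1 - l) a + rscale l a')) powr p
      \<le> ((1 - l) * (\<alpha> n * N0 a) + l * (\<alpha> n * N0 a')) powr p"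
  proof (intro powr_mono2)
    have "N0 (rscale (1 - l) a + rscale l a') \<le> N0 (rscale (1 - l) a) + N0 (rscale l a')"
      using a by (intro B0.norm_triangle B0.carrier_closed)
    also have "\<dots> = (1 - l) * N0 a + l * N0 a'"
      using a l by (simp only: B0.norm_scale norm_of_real abs_of_nonneg diff_ge_0_iff_ge)
    finally have "\<alpha> n * N0 (rscale (1 - l) a + rscale l a') \<le> \<alpha> n * ((1 - l) * N0 a + l * N0 a')"
      using weight_pos[of n] by (intro mult_left_mono) auto
    then show "\<alpha> n * N0 (rscale (1 - l) a + rscale l a') \<le> (1 - l) * (\<alpha> n * N0 a) + l * (\<alpha> n * N0 a')"
      by (simp add: algebra_simps)
    show "0 \<le> \<alpha> n * N0 (rscale (1 - l) a + rscale l a')"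
      using a weight_pos[of n] by (intro mult_nonneg_nonneg B0.norm_nonneg B0.carrier_closed) auto
  qed (use p_pos in simp)
  also have "\<dots> \<le> (1 - l) * (\<alpha> n * N0 a) powr p + l * (\<alpha> n * N0 a') powr p"
    using a l p_ge_1 weight_pos[of n] B0.norm_nonneg by (intro powr_convex_comb) (auto simp: less_imp_le)
  finally have 1: "(\<alpha> n * N0 (rscale (1 - l) a + rscale l a')) powr p \<le> \<dots>" .
  have "(\<beta> n * N1 (rscale (1 - l) b + rscale l b')) powr p
      \<le> ((1 - l) * (\<beta> n * N1 b) + l * (\<beta> n * N1 b')) powr p"
  proof (intro powr_mono2)
    have "N1 (rscale (1 - l) b + rscale l b') \<le> N1 (rscale (1 - l) b) + N1 (rscale l b')"
      using b by (intro B1.norm_triangle B1.carrier_closed)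
    also have "\<dots> = (1 - l) * N1 b + l * N1 b'"
      using b l by (simp only: B1.norm_scale norm_of_real abs_of_nonneg diff_ge_0_iff_ge)
    finally have "\<beta> n * N1 (rscale (1 - l) b + rscale l b') \<le> \<beta> n * ((1 - l) * N1 b + l * N1 b')"
      using weight_pos[of n] by (intro mult_left_mono) auto
    then show "\<beta> n * N1 (rscale (1 - l) b + rscale l b') \<le> (1 - l) * (\<beta> n * N1 b) + l * (\<beta> n * N1 b')"
      by (simp add: algebra_simps)
    show "0 \<le> \<beta> n * N1 (rscale (1 - l) b + rscale l b')"
      using b weight_pos[of n] by (intro mult_nonneg_nonneg B1.norm_nonneg B1.carrier_closed) auto
  qed (use p_pos in simp)
  also have "\<dots> \<le> (1 - l) * (\<beta> n * N1 b) powr p + l * (\<beta> n * N1 b') powr p"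
    using b l p_ge_1 weight_pos[of n] B1.norm_nonneg by (intro powr_convex_comb) (auto simp: less_imp_le)
  finally have 2: "(\<beta> n * N1 (rscale (1 - l) b + rscale l b')) powr p \<le> \<dots>" .
  show ?thesis
    unfolding cost_def using add_mono[OF 1 2] by (simp add: algebra_simps)
qed

text \<open>Minimising a jointly convex function over decompositions keeps it convex: nearly optimal
  decompositions of \<open>x\<close> and \<open>y\<close> are combined with the same
  weights.\<close>

lemma \<Psi>_convex:
  assumes l: "0 \<le> l" "l \<le> 1" and x: "x \<in> sum_space" and y: "y \<in> sum_space"
  shows "\<Psi> n (rscale (1 - l) x + rscale l y) \<le> (1 - l) * \<Psi> n x + l * \<Psi> n y"
proof (rule field_le_epsilon)
  fix e :: real assume e: "0 < e"
  obtain a b where ab: "a \<in> B0" "b \<in> B1" "x = a + b" "cost n a b < \<Psi> n x + e"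
    using \<Psi>_approx[OF x, of n "\<Psi> n x + e"] e by auto
  obtain a' b' where ab': "a' \<in> B0" "b' \<in> B1" "y = a' + b'" "cost n a' b' < \<Psi> n y + e"
    using \<Psi>_approx[OF y, of n "\<Psi> n y + e"] e by auto
  have "rscale (1 - l) x + rscale l y =
      (rscale (1 - l) a + rscale l a') + (rscale (1 - l) b + rscale l b')"
    unfolding ab ab' by (simp add: B0.scale_right_distrib)
  then have "\<Psi> n (rscale (1 - l) x + rscale l y) \<le>
      cost n (rscale (1 - l) a + rscale l a') (rscale (1 - l) b + rscale l b')"
    using ab ab' by (simp only:) (intro \<Psi>_le B0.carrier_closed B1.carrier_closed)
  also have "\<dots> \<le> (1 - l) * cost n a b + l * cost n a' b'"
    by (rule cost_convex) fact+
  also have "\<dots> \<le> (1 - l) * (\<Psi> n x + e) + l * (\<Psi> n y + e)"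
    using l ab ab' by (intro add_mono mult_left_mono) auto
  finally show "\<Psi> n (rscale (1 - l) x + rscale l y) \<le> (1 - l) * \<Psi> n x + l * \<Psi> n y + e"
    by (simp add: algebra_simps)
qed

lemma cost_scale:
  assumes "a \<in> B0" "b \<in> B1"
  shows "cost n (scl c a) (scl c b) = cmod c powr p * cost n a b"
proof -
  have "\<alpha> n * (cmod c * N0 a) = cmod c * (\<alpha> n * N0 a)" "\<beta> n * (cmod c * N1 b) = cmod c * (\<beta> n * N1 b)"
    by simp_all
  then show ?thesis
    using assms weight_pos[of n] B0.norm_nonneg[OF assms(1)] B1.norm_nonneg[OF assms(2)]
    by (simp only: cost_def B0.norm_scale B1.norm_scale) (simp add: powr_mult distrib_left)
qed

lemma \<Psi>_scale:
  assumes x: "x \<in> sum_space"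
  shows "\<Psi> n (scl c x) = cmod c powr p * \<Psi> n x"
proof -
  have le: "\<Psi> n (scl c x) \<le> cmod c powr p * \<Psi> n x" if c: "c \<noteq> 0" and x: "x \<in> sum_space" for c x
  proof -
    have "\<Psi> n (scl c x) / cmod c powr p \<le> \<Psi> n x"
    proof (rule \<Psi>_greatest[OF x])
      fix a b assume ab: "a \<in> B0" "b \<in> B1" "x = a + b"
      have "\<Psi> n (scl c x) \<le> cost n (scl c a) (scl c b)"
        unfolding ab(3) B0.scale_right_distrib using ab
        by (intro \<Psi>_le B0.carrier_closed B1.carrier_closed)
      then show "\<Psi> n (scl c x) / cmod c powr p \<le> cost n a b"
        using ab c by (simp add: cost_scale field_simps)
    qed
    then show ?thesis
      using c by (simp add: field_simps)
  qed
  show ?thesis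
  proof (cases "c = 0")
    case True
    have "\<Psi> n (0 + 0) \<le> cost n 0 0"
      by (intro \<Psi>_le B0.carrier_closed B1.carrier_closed)
    then have "\<Psi> n 0 = 0"
      using \<Psi>_nonneg[OF sum_space_closed(1), of n] by (simp add: cost_def B0.norm_zero B1.norm_zero)
    then show ?thesis using True by simp
  next
    case False
    \<comment> \<open>The inequality for \<open>inverse c\<close> at the point
      \<open>scl c x\<close> is the reverse one.\<close>
    have "\<Psi> n (scl (inverse c) (scl c x)) \<le> cmod (inverse c) powr p * \<Psi> n (scl c x)"
      using False x by (intro le sum_space_closed) auto
    then have "cmod c powr p * \<Psi> n x \<le> \<Psi> n (scl c x)"
      using False by (simp add: norm_inverse powr_divide field_simps inverse_eq_divide norm_divide)
    then show ?thesis
      using le[OF False x] by simp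
  qed
qed

lemma \<Psi>_minus: "x \<in> sum_space \<Longrightarrow> \<Psi> n (- x) = \<Psi> n x"
  using \<Psi>_scale[of x n "- 1"] by (simp add: B0.scale_minus_left)

lemma \<Psi>_zero: "\<Psi> n 0 = 0"
  using \<Psi>_scale[OF sum_space_closed(1), of n 0] p_pos by simp

text \<open>Convexity at \<open>l = 1 / 2\<close>, with \<open>2 powr p\<close> coming from
  homogeneity since \<open>x + y\<close> is twice the midpoint. It makes every term of the series of
  gaps nonnegative.\<close>

lemma \<Psi>_midpoint:
  assumes "x \<in> sum_space" "y \<in> sum_space"
  shows "\<Psi> n (x + y) / 2 powr p \<le> (\<Psi> n x + \<Psi> n y) / 2"
proof -
  have eq: "x + y = scl 2 (rscale (1 - 1 / 2) x + rscale (1 / 2) y)"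
    by (simp add: B0.scale_right_distrib)
  have "\<Psi> n (x + y) = 2 powr p * \<Psi> n (rscale (1 - 1 / 2) x + rscale (1 / 2) y)"
    unfolding eq using assms by (subst \<Psi>_scale) (auto intro!: sum_space_closed)
  then show ?thesis
    using \<Psi>_convex[of "1 / 2" x y n] assms by simp
qed

lemma \<Psi>_add_le:
  assumes "x \<in> sum_space" "y \<in> sum_space"
  shows "\<Psi> n (x + y) \<le> 2 powr p * (\<Psi> n x + \<Psi> n y)"
proof -
  have "\<Psi> n (x + y) \<le> 2 powr p * ((\<Psi> n x + \<Psi> n y) / 2)"
    using \<Psi>_midpoint[OF assms, of n] by (simp add: field_simps)
  also have "\<dots> \<le> 2 powr p * (\<Psi> n x + \<Psi> n y)"
    using \<Psi>_nonneg assms by (intro mult_left_mono) auto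
  finally show ?thesis .
qed

lemma \<Psi>_triangle:
  assumes "x \<in> sum_space" "y \<in> sum_space"
  shows "\<Psi> n (x + y) powr (1 / p) \<le> \<Psi> n x powr (1 / p) + \<Psi> n y powr (1 / p)"
  by (rule homogeneous_convex_powr_triangle[OF real_vs real_subspace[OF vs sum_space_subspace] p_pos])
    (use assms in \<open>simp_all add: \<Psi>_nonneg \<Psi>_scale \<Psi>_convex del: of_real_diff\<close>)

definition comparison :: "nat \<Rightarrow> real" where
  "comparison n = (\<alpha> n / \<alpha> 0) powr p + (\<beta> n / \<beta> 0) powr p"

lemma \<Psi>_le_\<Psi>_0:
  assumes x: "x \<in> sum_space"
  shows "\<Psi> n x \<le> comparison n * \<Psi> 0 x"
proof -
  have pos: "0 < comparison n"
    using weight_pos[of n] weight_pos[of 0] by (simp add: comparison_def add_pos_pos)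
  have "\<Psi> n x / comparison n \<le> \<Psi> 0 x"
  proof (rule \<Psi>_greatest[OF x])
    fix a b assume ab: "a \<in> B0" "b \<in> B1" "x = a + b"
    define u v where "u = (\<alpha> 0 * N0 a) powr p" and "v = (\<beta> 0 * N1 b) powr p"
    have "\<alpha> n * N0 a = (\<alpha> n / \<alpha> 0) * (\<alpha> 0 * N0 a)" "\<beta> n * N1 b = (\<beta> n / \<beta> 0) * (\<beta> 0 * N1 b)"
      using weight_pos[of 0] by simp_all
    then have "cost n a b = (\<alpha> n / \<alpha> 0) powr p * u + (\<beta> n / \<beta> 0) powr p * v"
      unfolding cost_def u_def v_def using ab weight_pos[of n] weight_pos[of 0] B0.norm_nonneg B1.norm_nonneg
      by (simp only: powr_mult)
    also have "\<dots> \<le> comparison n * (u + v)"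
      by (simp add: comparison_def algebra_simps u_def v_def)
    finally have "\<Psi> n x \<le> comparison n * cost 0 a b"
      using \<Psi>_le[OF ab(1,2), of n] ab(3) by (simp add: cost_def u_def v_def)
    then show "\<Psi> n x / comparison n \<le> cost 0 a b"
      using pos by (simp add: field_simps)
  qed
  then show ?thesis
    using pos by (simp add: field_simps)
qed

section \<open>The norm of \<open>B0 + B1\<close>: separation and completeness\<close>

lemma sum_norm_powr: "x \<in> sum_space \<Longrightarrow> sum_norm x powr p = \<Psi> 0 x"
  unfolding sum_norm_def using p_pos \<Psi>_nonneg[of x 0] by (simp add: powr_powr)

lemma sum_norm_nonneg: "0 \<le> sum_norm x"
  by (simp add: sum_norm_def)

lemma sum_norm_scale: "x \<in> sum_space \<Longrightarrow> sum_norm (scl c x) = cmod c * sum_norm x"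
  unfolding sum_norm_def using p_pos \<Psi>_nonneg[of x 0] by (simp add: \<Psi>_scale powr_mult powr_powr)

lemma sum_norm_triangle:
  "x \<in> sum_space \<Longrightarrow> y \<in> sum_space \<Longrightarrow> sum_norm (x + y) \<le> sum_norm x + sum_norm y"
  unfolding sum_norm_def by (rule \<Psi>_triangle)

lemma sum_norm_le_0: "a \<in> B0 \<Longrightarrow> sum_norm a \<le> \<alpha> 0 * N0 a"
proof -
  assume a: "a \<in> B0"
  have nn: "0 \<le> \<alpha> 0 * N0 a"
    using weight_pos[of 0] B0.norm_nonneg[OF a] by simp
  have "\<Psi> 0 a \<le> (\<alpha> 0 * N0 a) powr p"
    using \<Psi>_le[OF a B1.carrier_closed(1), of 0] by (simp add: cost_def B1.norm_zero)
  then have "sum_norm a \<le> ((\<alpha> 0 * N0 a) powr p) powr (1 / p)"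
    unfolding sum_norm_def using p_pos \<Psi>_nonneg[OF sum_spaceI[OF a B1.carrier_closed(1)], of 0]
    by (intro powr_mono2) auto
  also have "\<dots> = \<alpha> 0 * N0 a"
    using p_pos nn by (simp add: powr_powr)
  finally show ?thesis .
qed

lemma sum_norm_le_1: "b \<in> B1 \<Longrightarrow> sum_norm b \<le> \<beta> 0 * N1 b"
proof -
  assume b: "b \<in> B1"
  have nn: "0 \<le> \<beta> 0 * N1 b"
    using weight_pos[of 0] B1.norm_nonneg[OF b] by simp
  have "\<Psi> 0 b \<le> (\<beta> 0 * N1 b) powr p"
    using \<Psi>_le[OF B0.carrier_closed(1) b, of 0] by (simp add: cost_def B0.norm_zero)
  then have "sum_norm b \<le> ((\<beta> 0 * N1 b) powr p) powr (1 / p)"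
    unfolding sum_norm_def using p_pos \<Psi>_nonneg[OF sum_spaceI[OF B0.carrier_closed(1) b], of 0]
    by (intro powr_mono2) auto
  also have "\<dots> = \<beta> 0 * N1 b"
    using p_pos nn by (simp add: powr_powr)
  finally show ?thesis .
qed

lemma carrier_le_sum_space: "B0 \<subseteq> sum_space" "B1 \<subseteq> sum_space"
  using sum_spaceI[OF _ B1.carrier_closed(1)] sum_spaceI[OF B0.carrier_closed(1)] by auto

lemma \<Psi>_seminorm_approx:
  assumes x: "x \<in> sum_space" and e: "\<Psi> n x powr (1 / p) < e"
  obtains a b where "a \<in> B0" "b \<in> B1" "x = a + b" "\<alpha> n * N0 a < e" "\<beta> n * N1 b < e"
proof -
  have e0: "0 < e" using e powr_ge_zero[of "\<Psi> n x" "1 / p"] by linarith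
  have "(\<Psi> n x powr (1 / p)) powr p < e powr p"
    using e p_pos by (intro powr_less_mono2) auto
  then have "\<Psi> n x < e powr p"
    using p_pos \<Psi>_nonneg[OF x, of n] by (simp add: powr_powr)
  then obtain a b where ab: "a \<in> B0" "b \<in> B1" "x = a + b" "cost n a b < e powr p"
    by (rule \<Psi>_approx[OF x])
  have "(\<alpha> n * N0 a) powr p < e powr p" "(\<beta> n * N1 b) powr p < e powr p"
    using ab(4) powr_ge_zero[of "\<alpha> n * N0 a" p] powr_ge_zero[of "\<beta> n * N1 b" p]
    unfolding cost_def by linarith+
  then have "\<alpha> n * N0 a < e" "\<beta> n * N1 b < e"
    using p_pos e0 by (auto intro: powr_less_imp_less)
  then show ?thesis using that ab by blast
qed

text \<open>Here the common Hausdorff space enters: \<open>x\<close> decomposes into parts that tend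
  to 0 in \<open>N0\<close> and in \<open>N1\<close>, hence in the ambient topology, so the constant
  sequence \<open>x\<close> converges to 0.\<close>

lemma sum_norm_eq_0:
  assumes x: "x \<in> sum_space" and "sum_norm x = 0"
  shows "x = 0"
proof -
  have "\<exists>a b. a \<in> B0 \<and> b \<in> B1 \<and> x = a + b \<and> \<alpha> 0 * N0 a < inverse (real (Suc n)) \<and>
      \<beta> 0 * N1 b < inverse (real (Suc n))" for n
    by (rule \<Psi>_seminorm_approx[OF x, of 0 "inverse (real (Suc n))"])
      (use assms(2) in \<open>auto simp: sum_norm_def\<close>)
  then obtain a b where ab: "\<And>n. a n \<in> B0" "\<And>n. b n \<in> B1" "\<And>n. x = a n + b n"
    "\<And>n. \<alpha> 0 * N0 (a n) < inverse (real (Suc n))" "\<And>n. \<beta> 0 * N1 (b n) < inverse (real (Suc n))"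
    by metis
  have "(\<lambda>n. \<alpha> 0 * N0 (a n)) \<longlonglongrightarrow> 0"
    by (rule tendsto_sandwich[OF _ _ tendsto_const LIMSEQ_inverse_real_of_nat])
      (use ab weight_pos[of 0] B0.norm_nonneg in \<open>auto intro!: always_eventually less_imp_le\<close>)
  then have "(\<lambda>n. N0 (a n - 0)) \<longlonglongrightarrow> 0"
    using weight_pos[of 0] tendsto_mult_left_iff[of "\<alpha> 0" "\<lambda>n. N0 (a n)" 0] by simp
  then have "limitin B0.norm.mtopology a 0 sequentially"
    using B0.norm_limitin_iff[of a 0] ab B0.carrier_closed by blast
  then have a0: "a \<longlonglongrightarrow> 0"
    using continuous_map_limit[OF continuous_embedding_0] by (fastforce simp: o_def)
  have "(\<lambda>n. \<beta> 0 * N1 (b n)) \<longlonglongrightarrow> 0"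
    by (rule tendsto_sandwich[OF _ _ tendsto_const LIMSEQ_inverse_real_of_nat])
      (use ab weight_pos[of 0] B1.norm_nonneg in \<open>auto intro!: always_eventually less_imp_le\<close>)
  then have "(\<lambda>n. N1 (b n - 0)) \<longlonglongrightarrow> 0"
    using weight_pos[of 0] tendsto_mult_left_iff[of "\<beta> 0" "\<lambda>n. N1 (b n)" 0] by simp
  then have "limitin B1.norm.mtopology b 0 sequentially"
    using B1.norm_limitin_iff[of b 0] ab B1.carrier_closed by blast
  then have b0: "b \<longlonglongrightarrow> 0"
    using continuous_map_limit[OF continuous_embedding_1] by (fastforce simp: o_def)
  have "(\<lambda>n. x) = (\<lambda>n. a n + b n)"
    using ab(3) by auto
  then have "(\<lambda>n. x) \<longlonglongrightarrow> 0"
    using tendsto_add[OF a0 b0] by simp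
  then show ?thesis
    by (simp add: tendsto_const_iff)
qed

text \<open>Along a fast subsequence the increments split into \<open>B0\<close>- and
  \<open>B1\<close>-parts with geometric bounds. Their sums converge in the two Banach spaces
  separately, and a Cauchy sequence follows its subsequence.\<close>

lemma sum_space_complete:
  assumes z: "\<And>n. z n \<in> sum_space"
    and cauchy: "\<And>e. 0 < e \<Longrightarrow> \<exists>M. \<forall>m\<ge>M. \<forall>n\<ge>M. sum_norm (z m - z n) < e"
  shows "\<exists>x\<in>sum_space. (\<lambda>n. sum_norm (z n - x)) \<longlonglongrightarrow> 0"
proof -
  have "\<forall>k. \<exists>M. \<forall>m\<ge>M. \<forall>n\<ge>M. sum_norm (z m - z n) < (1 / 2) ^ k"
    using cauchy by simp
  then obtain M where M: "\<And>k m n. M k \<le> m \<Longrightarrow> M k \<le> n \<Longrightarrow> sum_norm (z m - z n) < (1 / 2) ^ k"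
    by metis
  \<comment> \<open>Partial sums are nondecreasing and dominate \<open>M k\<close>, so
    \<open>r k\<close> and \<open>r (Suc k)\<close> both lie beyond \<open>M k\<close>.\<close>
  define r where "r k = (\<Sum>i\<le>k. M i)" for k
  have r: "M k \<le> r k" "r k \<le> r (Suc k)" for k
    unfolding r_def by (auto intro: member_le_sum)
  have "\<exists>a b. a \<in> B0 \<and> b \<in> B1 \<and> z (r (Suc k)) - z (r k) = a + b \<and> \<alpha> 0 * N0 a < (1 / 2) ^ k \<and>
      \<beta> 0 * N1 b < (1 / 2) ^ k" for k
    by (rule \<Psi>_seminorm_approx[of "z (r (Suc k)) - z (r k)" 0 "(1 / 2) ^ k"])
      (use M[of k "r (Suc k)" "r k"] r[of k] z sum_space_closed(3) in \<open>auto simp: sum_norm_def\<close>)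
  then obtain a b where ab: "\<And>k. a k \<in> B0" "\<And>k. b k \<in> B1" "\<And>k. z (r (Suc k)) - z (r k) = a k + b k"
    "\<And>k. \<alpha> 0 * N0 (a k) < (1 / 2) ^ k" "\<And>k. \<beta> 0 * N1 (b k) < (1 / 2) ^ k"
    by metis
  have "N0 (a k) \<le> (1 / \<alpha> 0) * (1 / 2) ^ k" "N1 (b k) \<le> (1 / \<beta> 0) * (1 / 2) ^ k" for k
    using ab(4,5)[of k] weight_pos[of 0] by (simp_all add: field_simps)
  from B0.geometric_series_converges[OF ab(1) this(1)] B1.geometric_series_converges[OF ab(2) this(2)]
  obtain u v where uv: "u \<in> B0" "(\<lambda>k. N0 ((\<Sum>i<k. a i) - u)) \<longlonglongrightarrow> 0"
    "v \<in> B1" "(\<lambda>k. N1 ((\<Sum>i<k. b i) - v)) \<longlonglongrightarrow> 0"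
    by blast
  define x where "x = z (r 0) + (u + v)"
  have x: "x \<in> sum_space"
    unfolding x_def using z uv by (intro sum_space_closed sum_spaceI)
  have zr: "z (r k) = z (r 0) + ((\<Sum>i<k. a i) + (\<Sum>i<k. b i))" for k
  proof (induction k)
    case (Suc k)
    have "z (r (Suc k)) = z (r k) + (a k + b k)"
      using ab(3)[of k] by (simp add: algebra_simps)
    then show ?case using Suc by (simp add: algebra_simps)
  qed simp
  have D: "(\<Sum>i<k. a i) - u \<in> B0" "(\<Sum>i<k. b i) - v \<in> B1" for k
    using ab uv by (auto intro!: B0.carrier_closed B1.carrier_closed B0.subspace_sum
        B0.subspace_carrier B1.subspace_carrier)
  have sub: "(\<lambda>k. sum_norm (z (r k) - x)) \<longlonglongrightarrow> 0"
  proof (rule tendsto_sandwich[where f = "\<lambda>_. 0"])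
    have "sum_norm (z (r k) - x) \<le> \<alpha> 0 * N0 ((\<Sum>i<k. a i) - u) + \<beta> 0 * N1 ((\<Sum>i<k. b i) - v)" for k
    proof -
      have "z (r k) - x = ((\<Sum>i<k. a i) - u) + ((\<Sum>i<k. b i) - v)"
        unfolding x_def zr[of k] by (simp add: algebra_simps)
      then have "sum_norm (z (r k) - x) \<le> sum_norm ((\<Sum>i<k. a i) - u) + sum_norm ((\<Sum>i<k. b i) - v)"
        using D carrier_le_sum_space by (simp only:) (intro sum_norm_triangle, auto)
      also have "\<dots> \<le> \<alpha> 0 * N0 ((\<Sum>i<k. a i) - u) + \<beta> 0 * N1 ((\<Sum>i<k. b i) - v)"
        using D by (intro add_mono sum_norm_le_0 sum_norm_le_1)
      finally show ?thesis .
    qed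
    then show "\<forall>\<^sub>F k in sequentially. sum_norm (z (r k) - x) \<le>
        \<alpha> 0 * N0 ((\<Sum>i<k. a i) - u) + \<beta> 0 * N1 ((\<Sum>i<k. b i) - v)"
      by simp
    show "(\<lambda>k. \<alpha> 0 * N0 ((\<Sum>i<k. a i) - u) + \<beta> 0 * N1 ((\<Sum>i<k. b i) - v)) \<longlonglongrightarrow> 0"
      using tendsto_add[OF tendsto_mult_right_zero[OF uv(2)] tendsto_mult_right_zero[OF uv(4)]] by simp
  qed (use sum_norm_nonneg in auto)
  have "(\<lambda>n. sum_norm (z n - x)) \<longlonglongrightarrow> 0"
  proof (rule LIMSEQ_I)
    fix e :: real assume e: "0 < e"
    then obtain k0 where k0: "\<And>k. k0 \<le> k \<Longrightarrow> sum_norm (z (r k) - x) < e / 2"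
      using LIMSEQ_D[OF sub, of "e / 2"] sum_norm_nonneg by auto
    obtain k1 where k1: "(1 / 2) ^ k1 < e / 2"
      using real_arch_pow_inv[of "e / 2" "1 / 2"] e by auto
    define k where "k = max k0 k1"
    have k: "(1 / 2) ^ k < e / 2"
      by (rule order_le_less_trans[OF power_decreasing k1]) (simp_all add: k_def)
    have "sum_norm (z n - x) < e" if "r k \<le> n" for n
    proof -
      have "sum_norm ((z n - z (r k)) + (z (r k) - x)) \<le> sum_norm (z n - z (r k)) + sum_norm (z (r k) - x)"
        using z x by (intro sum_norm_triangle sum_space_closed)
      moreover have "sum_norm (z n - z (r k)) < (1 / 2) ^ k"
        using r(1)[of k] that by (intro M) auto
      moreover have "sum_norm (z (r k) - x) < e / 2"
        by (rule k0) (simp add: k_def)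
      ultimately show ?thesis
        using k by simp
    qed
    then show "\<exists>no. \<forall>n\<ge>no. norm (sum_norm (z n - x) - 0) < e"
      using sum_norm_nonneg by auto
  qed
  with x show ?thesis by blast
qed

end

section \<open>The discrete interpolation space\<close>

lemma (in complex_normed_space) norm_powr_midpoint:
  assumes "1 \<le> q" "x \<in> X" "y \<in> X"
  shows "(N (x + y) / 2) powr q \<le> (N x powr q + N y powr q) / 2"
proof -
  have "(N (x + y) / 2) powr q \<le> ((1 - 1 / 2) * N x + 1 / 2 * N y) powr q"
    using assms norm_triangle[of x y] norm_nonneg carrier_closed(2) by (intro powr_mono2) auto
  also have "\<dots> \<le> (1 - 1 / 2) * N x powr q + 1 / 2 * N y powr q"
    using assms norm_nonneg by (intro powr_convex_comb) auto
  finally show ?thesis by (simp add: add_divide_distrib)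
qed

lemma linear_on_set_subset: "linear_on_set s Y g \<Longrightarrow> X \<subseteq> Y \<Longrightarrow> linear_on_set s X g"
  unfolding linear_on_set_def by blast

context weighted_couple
begin

text \<open>Sending \<open>x\<close> to the constant sequence with value \<open>x\<close> embeds
  this space in the p-summable direct sum of copies of \<open>B0 + B1\<close>, the n-th one normed
  by \<open>\<Psi> n x powr (1 / p)\<close>.\<close>

definition lp_space :: "'v set" where
  "lp_space = {x \<in> sum_space. summable (\<lambda>n. \<Psi> n x)}"

definition \<Phi> :: "'v \<Rightarrow> real" where
  "\<Phi> x = (\<Sum>n. \<Psi> n x)"

definition lp_norm :: "'v \<Rightarrow> real" where
  "lp_norm x = \<Phi> x powr (1 / p)"

lemma lp_spaceD: "x \<in> lp_space \<Longrightarrow> x \<in> sum_space" "x \<in> lp_space \<Longrightarrow> summable (\<lambda>n. \<Psi> n x)"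
  by (auto simp: lp_space_def)

lemma lp_space_subspace: "B0.subspace lp_space"
proof (rule B0.subspaceI)
  show "0 \<in> lp_space"
    by (simp add: lp_space_def sum_space_closed \<Psi>_zero)
  fix x y assume xy: "x \<in> lp_space" "y \<in> lp_space"
  have "summable (\<lambda>n. \<Psi> n (x + y))"
  proof (rule summable_comparison_test')
    show "summable (\<lambda>n. 2 powr p * (\<Psi> n x + \<Psi> n y))"
      using xy by (intro summable_mult summable_add lp_spaceD)
    show "norm (\<Psi> n (x + y)) \<le> 2 powr p * (\<Psi> n x + \<Psi> n y)" if "n \<ge> 0" for n
      using xy[THEN lp_spaceD(1)] by (simp add: \<Psi>_nonneg sum_space_closed \<Psi>_add_le)
  qed
  then show "x + y \<in> lp_space"
    using xy by (simp add: lp_space_def sum_space_closed)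
next
  fix c x assume "x \<in> lp_space"
  then show "scl c x \<in> lp_space"
    by (simp add: lp_space_def sum_space_closed \<Psi>_scale summable_mult)
qed

lemma lp_space_closed:
  "0 \<in> lp_space" "x \<in> lp_space \<Longrightarrow> y \<in> lp_space \<Longrightarrow> x + y \<in> lp_space"
  "x \<in> lp_space \<Longrightarrow> y \<in> lp_space \<Longrightarrow> x - y \<in> lp_space"
  "x \<in> lp_space \<Longrightarrow> scl c x \<in> lp_space"
  using lp_space_subspace B0.subspace_0 B0.subspace_add B0.subspace_diff B0.subspace_scale by auto

lemma \<Phi>_nonneg: "x \<in> lp_space \<Longrightarrow> 0 \<le> \<Phi> x"
  unfolding \<Phi>_def by (intro suminf_nonneg) (auto dest: lp_spaceD intro: \<Psi>_nonneg)

lemma \<Phi>_scale: "x \<in> lp_space \<Longrightarrow> \<Phi> (scl c x) = cmod c powr p * \<Phi> x"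
  unfolding \<Phi>_def by (simp add: \<Psi>_scale lp_spaceD suminf_mult)

lemma \<Phi>_convex:
  assumes "0 \<le> l" "l \<le> 1" "x \<in> lp_space" "y \<in> lp_space"
  shows "\<Phi> (rscale (1 - l) x + rscale l y) \<le> (1 - l) * \<Phi> x + l * \<Phi> y"
proof -
  have "\<Phi> (rscale (1 - l) x + rscale l y) \<le> (\<Sum>n. (1 - l) * \<Psi> n x + l * \<Psi> n y)"
    unfolding \<Phi>_def
  proof (rule suminf_le)
    show "\<Psi> n (rscale (1 - l) x + rscale l y) \<le> (1 - l) * \<Psi> n x + l * \<Psi> n y" for n
      using assms by (intro \<Psi>_convex lp_spaceD)
    show "summable (\<lambda>n. \<Psi> n (rscale (1 - l) x + rscale l y))"
      using assms by (intro lp_spaceD lp_space_closed)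
    show "summable (\<lambda>n. (1 - l) * \<Psi> n x + l * \<Psi> n y)"
      using assms by (intro summable_add summable_mult lp_spaceD)
  qed
  also have "\<dots> = (1 - l) * \<Phi> x + l * \<Phi> y"
    unfolding \<Phi>_def using assms
    by (subst suminf_add[symmetric]) (auto intro!: summable_mult lp_spaceD simp: suminf_mult lp_spaceD)
  finally show ?thesis .
qed

lemma sum_\<Psi>_le_\<Phi>: "x \<in> lp_space \<Longrightarrow> finite I \<Longrightarrow> (\<Sum>n\<in>I. \<Psi> n x) \<le> \<Phi> x"
  unfolding \<Phi>_def by (intro sum_le_suminf) (auto dest: lp_spaceD intro: \<Psi>_nonneg)

lemma \<Psi>_le_\<Phi>: "x \<in> lp_space \<Longrightarrow> \<Psi> n x \<le> \<Phi> x"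
  using sum_\<Psi>_le_\<Phi>[of x "{n}"] by simp

lemma lp_norm_powr: "x \<in> lp_space \<Longrightarrow> lp_norm x powr p = \<Phi> x"
  unfolding lp_norm_def using p_pos \<Phi>_nonneg[of x] by (simp add: powr_powr)

lemma lp_norm_nonneg: "0 \<le> lp_norm x"
  by (simp add: lp_norm_def)

lemma lp_norm_scale: "x \<in> lp_space \<Longrightarrow> lp_norm (scl c x) = cmod c * lp_norm x"
  unfolding lp_norm_def using p_pos \<Phi>_nonneg[of x] by (simp add: \<Phi>_scale powr_mult powr_powr)

lemma lp_norm_triangle:
  assumes "x \<in> lp_space" "y \<in> lp_space"
  shows "lp_norm (x + y) \<le> lp_norm x + lp_norm y"
  unfolding lp_norm_def
  by (rule homogeneous_convex_powr_triangle[OF real_vs real_subspace[OF vs lp_space_subspace] p_pos])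
    (use assms in \<open>simp_all add: \<Phi>_nonneg \<Phi>_scale \<Phi>_convex del: of_real_diff\<close>)

lemma sum_norm_le_lp_norm: "x \<in> lp_space \<Longrightarrow> sum_norm x \<le> lp_norm x"
  unfolding lp_norm_def sum_norm_def using p_pos
  by (intro powr_mono2) (auto intro: \<Psi>_le_\<Phi> \<Psi>_nonneg dest: lp_spaceD)

lemma \<Psi>_tendsto_0:
  assumes "\<And>n. z n \<in> sum_space" "(\<lambda>n. sum_norm (z n)) \<longlonglongrightarrow> 0"
  shows "(\<lambda>n. \<Psi> j (z n)) \<longlonglongrightarrow> 0"
proof -
  have "(\<lambda>n. sum_norm (z n) powr p) \<longlonglongrightarrow> 0 powr p"
    using assms p_pos by (intro tendsto_powr') (auto simp: sum_norm_nonneg)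
  then have "(\<lambda>n. comparison j * \<Psi> 0 (z n)) \<longlonglongrightarrow> 0"
    using assms p_pos by (simp add: sum_norm_powr tendsto_mult_right_zero)
  from tendsto_sandwich[OF _ _ tendsto_const this] show ?thesis
    using assms by (simp add: \<Psi>_nonneg \<Psi>_le_\<Psi>_0)
qed

section \<open>The discrete space is a Banach space\<close>

lemma lp_complex_normed_space: "complex_normed_space scl lp_space lp_norm"
proof
  show "B0.subspace lp_space"
    by (rule lp_space_subspace)
  fix x assume x: "x \<in> lp_space"
  show "lp_norm x = 0 \<longleftrightarrow> x = 0"
  proof
    assume "lp_norm x = 0"
    then have "sum_norm x = 0"
      using sum_norm_le_lp_norm[OF x] sum_norm_nonneg[of x] by simp
    then show "x = 0"
      using sum_norm_eq_0 lp_spaceD(1)[OF x] by blast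
  next
    assume "x = 0"
    then show "lp_norm x = 0"
      using lp_norm_scale[OF x, of 0] by simp
  qed
qed (simp_all add: lp_norm_nonneg lp_norm_scale lp_norm_triangle)

text \<open>The limit comes from the weaker \<open>sum_norm\<close>. As in Fatou's lemma, each
  finite partial sum of \<open>\<Psi> j (z n - x)\<close> is estimated through
  \<open>z n - z m\<close> with \<open>m\<close> tending to infinity, and the bound does not depend
  on the number of terms.\<close>

lemma lp_complex_Banach_space: "complex_Banach_space scl lp_space lp_norm"
proof -
  interpret lp: complex_normed_space scl lp_space lp_norm
    by (rule lp_complex_normed_space)
  have "lp.norm.mcomplete"
    unfolding lp.norm.mcomplete_def
  proof (intro allI impI)
    fix z assume cau: "lp.norm.MCauchy z"
    have z: "z n \<in> lp_space" for n
      using cau unfolding lp.norm.MCauchy_def by auto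
    have zs: "z n \<in> sum_space" for n
      using z lp_spaceD by blast
    have cauchy: "\<exists>M. \<forall>m\<ge>M. \<forall>n\<ge>M. lp_norm (z m - z n) < e" if e: "0 < e" for e
    proof -
      obtain M where "\<forall>n n'. M \<le> n \<longrightarrow> M \<le> n' \<longrightarrow> lp.norm_dist (z n) (z n') < e"
        using cau e unfolding lp.norm.MCauchy_def by blast
      then show ?thesis
        using z by (intro exI[of _ M]) (simp add: lp.norm_dist_def)
    qed
    have "\<exists>M. \<forall>m\<ge>M. \<forall>n\<ge>M. sum_norm (z m - z n) < e" if e: "0 < e" for e
    proof -
      obtain M where "\<And>m n. M \<le> m \<Longrightarrow> M \<le> n \<Longrightarrow> lp_norm (z m - z n) < e"
        using cauchy[OF e] by blast
      then show ?thesis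
        by (intro exI[of _ M] allI impI
            order_le_less_trans[OF sum_norm_le_lp_norm[OF lp_space_closed(3)[OF z z]]])
    qed
    then obtain x where x: "x \<in> sum_space" "(\<lambda>n. sum_norm (z n - x)) \<longlonglongrightarrow> 0"
      using sum_space_complete[of z] zs by blast
    \<comment> \<open>The factor 2 is the p-th root of the constant \<open>2 powr p\<close> in
      \<open>\<Psi>_add_le\<close>.\<close>
    have key: "z n - x \<in> lp_space \<and> lp_norm (z n - x) \<le> 2 * e"
      if M: "\<forall>m\<ge>M. \<forall>n\<ge>M. lp_norm (z m - z n) < e" and n: "M \<le> n" and e: "0 < e" for M n e
    proof -
      have nx: "z n - x \<in> sum_space"
        using zs x by (intro sum_space_closed)
      have partial: "(\<Sum>j<J. \<Psi> j (z n - x)) \<le> 2 powr p * e powr p" for J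
      proof (rule LIMSEQ_le_const)
        have "(\<lambda>m. \<Sum>j<J. \<Psi> j (z m - x)) \<longlonglongrightarrow> (\<Sum>j<J. 0)"
          using zs x by (intro tendsto_sum \<Psi>_tendsto_0 sum_space_closed) auto
        then have "(\<lambda>m. \<Sum>j<J. \<Psi> j (z m - x)) \<longlonglongrightarrow> 0" by simp
        from tendsto_mult[OF tendsto_const tendsto_add[OF tendsto_const this], of "2 powr p" "e powr p"]
        show "(\<lambda>m. 2 powr p * (e powr p + (\<Sum>j<J. \<Psi> j (z m - x)))) \<longlonglongrightarrow> 2 powr p * e powr p"
          by simp
        have "(\<Sum>j<J. \<Psi> j (z n - x)) \<le> 2 powr p * (e powr p + (\<Sum>j<J. \<Psi> j (z m - x)))" if m: "M \<le> m" for m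
        proof -
          have "\<Psi> j (z n - x) \<le> 2 powr p * (\<Psi> j (z n - z m) + \<Psi> j (z m - x))" for j
            using \<Psi>_add_le[of "z n - z m" "z m - x" j] zs x sum_space_closed(3) by simp
          then have "(\<Sum>j<J. \<Psi> j (z n - x)) \<le> (\<Sum>j<J. 2 powr p * (\<Psi> j (z n - z m) + \<Psi> j (z m - x)))"
            by (rule sum_mono)
          also have "\<dots> = 2 powr p * ((\<Sum>j<J. \<Psi> j (z n - z m)) + (\<Sum>j<J. \<Psi> j (z m - x)))"
            by (simp only: sum.distrib sum_distrib_left[symmetric])
          also have "(\<Sum>j<J. \<Psi> j (z n - z m)) \<le> lp_norm (z n - z m) powr p"
            unfolding lp_norm_powr[OF lp_space_closed(3)[OF z z]]
          by (intro sum_\<Psi>_le_\<Phi> lp_space_closed z finite_lessThan)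
          also have "\<dots> \<le> e powr p"
            using M[rule_format, OF n m] p_pos lp_norm_nonneg by (intro powr_mono2) auto
          finally show ?thesis by simp
        qed
        then show "\<exists>N. \<forall>m\<ge>N. (\<Sum>j<J. \<Psi> j (z n - x)) \<le> 2 powr p * (e powr p + (\<Sum>j<J. \<Psi> j (z m - x)))"
          by blast
      qed
      have summ: "summable (\<lambda>j. \<Psi> j (z n - x))"
        by (rule summableI_nonneg_bounded[OF _ partial]) (rule \<Psi>_nonneg[OF nx])
      have "\<Phi> (z n - x) \<le> 2 powr p * e powr p"
        unfolding \<Phi>_def by (rule suminf_le_const[OF summ partial])
      also have "\<dots> = (2 * e) powr p"
        using e by (simp add: powr_mult)
      finally have "lp_norm (z n - x) \<le> ((2 * e) powr p) powr (1 / p)"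
        unfolding lp_norm_def using nx summ p_pos
        by (intro powr_mono2 \<Phi>_nonneg) (auto simp: lp_space_def)
      then show ?thesis
        using nx summ e p_pos by (simp add: lp_space_def powr_powr)
    qed
    obtain n where "\<forall>m\<ge>n. \<forall>k\<ge>n. lp_norm (z m - z k) < 1"
      using cauchy[of 1] zero_less_one by blast
    then have "z n - x \<in> lp_space"
      using key[of n 1 n] by simp
    then have xlp: "x \<in> lp_space"
      using lp_space_closed(3)[OF z[of n], of "z n - x"] by simp
    have "(\<lambda>n. lp_norm (z n - x)) \<longlonglongrightarrow> 0"
    proof (rule LIMSEQ_I)
      fix e :: real assume e: "0 < e"
      obtain M where M: "\<forall>m\<ge>M. \<forall>n\<ge>M. lp_norm (z m - z n) < e / 4"
        using cauchy[of "e / 4"] e by auto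
      have "norm (lp_norm (z n - x) - 0) < e" if "M \<le> n" for n
        using key[OF M that] e lp_norm_nonneg[of "z n - x"] by simp
      then show "\<exists>M. \<forall>n\<ge>M. norm (lp_norm (z n - x) - 0) < e"
        by blast
    qed
    then show "\<exists>x. limitin lp.norm.mtopology z x sequentially"
      using lp.norm_limitin_iff[of z x, OF z xlp] by blast
  qed
  then show ?thesis
    by (simp add: complex_Banach_space_def complex_Banach_space_axioms_def lp_complex_normed_space)
qed

text \<open>Gliding hump: if the bound failed, one could build sums \<open>s\<close> of \<open>m\<close> almost disjoint vectors
  with \<open>lp_norm s = O(m powr (1 / p))\<close> and \<open>R s \<ge> \<eta> * m\<close>, which is absurd as \<open>p > 1\<close>.\<close>

lemma functional_le_small_plus_sum_norm:
  assumes R: "linear_on_set rscale lp_space R" and C: "\<And>x. x \<in> lp_space \<Longrightarrow> \<bar>R x\<bar> \<le> C * lp_norm x"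
    and \<eta>: "0 < \<eta>"
  shows "\<exists>M\<ge>0. \<forall>x\<in>lp_space. \<bar>R x\<bar> \<le> \<eta> * lp_norm x + M * sum_norm x"
proof (rule ccontr)
  assume "\<not> ?thesis"
  then have contra: "\<exists>x\<in>lp_space. \<eta> * lp_norm x + M * sum_norm x < \<bar>R x\<bar>" if "0 \<le> M" for M
    using that by (meson not_le)
  have R_scale: "R (rscale r x) = r * R x" if "x \<in> lp_space" for x r
    using R that unfolding linear_on_set_def by blast
  have R_add: "R (x + y) = R x + R y" if "x \<in> lp_space" "y \<in> lp_space" for x y
    using R that unfolding linear_on_set_def by blast
  \<comment> \<open>Dividing by the norm and correcting the sign makes a counterexample a unit
    vector on which \<open>R\<close> itself is large.\<close>
  have "\<exists>w. w \<in> lp_space \<and> lp_norm w = 1 \<and> \<eta> + M * sum_norm w < R w" if M: "0 \<le> M" for M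
  proof -
    obtain x where x: "x \<in> lp_space" "\<eta> * lp_norm x + M * sum_norm x < \<bar>R x\<bar>"
      using contra[OF M] by blast
    have "lp_norm x \<noteq> 0"
    proof
      assume 0: "lp_norm x = 0"
      then have "\<bar>R x\<bar> \<le> 0" using C[OF x(1)] by simp
      moreover have "0 \<le> \<eta> * lp_norm x + M * sum_norm x"
        using \<eta> M sum_norm_nonneg lp_norm_nonneg by simp
      ultimately show False using x(2) by simp
    qed
    then have pos: "0 < lp_norm x" using lp_norm_nonneg[of x] by simp
    define r where "r = sgn (R x) / lp_norm x"
    have "R x \<noteq> 0"
    proof
      assume "R x = 0"
      moreover have "0 \<le> \<eta> * lp_norm x + M * sum_norm x"
        using \<eta> M sum_norm_nonneg lp_norm_nonneg by simp
      ultimately show False using x(2) by simp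
    qed
    then have r: "\<bar>r\<bar> = 1 / lp_norm x" "r * R x = \<bar>R x\<bar> / lp_norm x"
      using pos by (simp_all add: r_def abs_mult abs_sgn_eq mult.commute[of "sgn (R x)"] abs_sgn)
    have "\<eta> + M * (sum_norm x / lp_norm x) < \<bar>R x\<bar> / lp_norm x"
      using divide_strict_right_mono[OF x(2) pos] pos by (simp add: add_divide_distrib)
    then show ?thesis
      using x pos r lp_spaceD(1)[OF x(1)]
      by (intro exI[of _ "rscale r x"])
        (simp add: lp_space_closed lp_norm_scale sum_norm_scale R_scale)
  qed
  then have "\<exists>w. w \<in> lp_space \<and> lp_norm w = 1 \<and> \<eta> + real (Suc n) * sum_norm w < R w" for n
    by simp
  then obtain w where w: "\<And>n. w n \<in> lp_space" "\<And>n. lp_norm (w n) = 1"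
    "\<And>n. \<eta> + real (Suc n) * sum_norm (w n) < R (w n)"
    by metis
  have ws: "w n \<in> sum_space" for n
    using w lp_spaceD by blast
  have \<Phi>w: "\<Phi> (w n) = 1" for n
    using lp_norm_powr[OF w(1)[of n]] w(2) by simp
  have Rw: "\<eta> \<le> R (w n)" for n
    using w(3)[of n] sum_norm_nonneg[of "w n"] by (smt (verit) mult_nonneg_nonneg of_nat_0_le_iff)
  \<comment> \<open>On unit vectors \<open>R\<close> is at most \<open>C\<close>, while the violated
    bound carries the factor \<open>Suc n\<close> before \<open>sum_norm\<close>.\<close>
  have "sum_norm (w n) \<le> C * inverse (real (Suc n))" for n
  proof -
    have "real (Suc n) * sum_norm (w n) \<le> C"
      using w(3)[of n] C[OF w(1)[of n]] w(2)[of n] \<eta> by simp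
    then show ?thesis
      by (simp add: field_simps)
  qed
  then have "(\<lambda>n. sum_norm (w n)) \<longlonglongrightarrow> 0"
    by (intro tendsto_sandwich[OF _ _ tendsto_const tendsto_mult_right_zero[OF LIMSEQ_inverse_real_of_nat, of C]])
      (auto simp: sum_norm_nonneg)
  then have \<Psi>w: "(\<lambda>n. \<Psi> j (w n)) \<longlonglongrightarrow> 0" for j
    using ws by (intro \<Psi>_tendsto_0)
  \<comment> \<open>Cost of adding one vector: 1 for the change in the first \<open>J\<close> terms,
    and \<open>2 powr p * (1 + 1)\<close> for the tails of \<open>s\<close> and of the unit vector,
    each at most 1.\<close>
  define L where "L = 1 + 2 powr p * 2"
  have L: "0 < L"
    unfolding L_def by (intro add_pos_nonneg) auto
  \<comment> \<open>The first \<open>J\<close> terms nearly exhaust \<open>\<Phi> s\<close>, and a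
    late \<open>w n\<close> hardly alters those terms; this replaces exact disjointness.\<close>
  have step: "\<exists>n. \<Phi> (s + w n) \<le> \<Phi> s + L" if s: "s \<in> lp_space" for s
  proof -
    have ss: "s \<in> sum_space" using s lp_spaceD by blast
    obtain J where J: "norm (\<Sum>i. \<Psi> (i + J) s) < 1"
      using suminf_exist_split[of 1 "\<lambda>i. \<Psi> i s"] lp_spaceD(2)[OF s] by auto
    have "(\<lambda>n. \<Psi> j (s + w n)) \<longlonglongrightarrow> \<Psi> j s" for j
    proof -
      have bound: "\<bar>\<Psi> j (s + w n) powr (1 / p) - \<Psi> j s powr (1 / p)\<bar> \<le> \<Psi> j (w n) powr (1 / p)" for n
      proof -
        have "\<Psi> j (s + w n + - w n) powr (1 / p) \<le> \<Psi> j (s + w n) powr (1 / p) + \<Psi> j (- w n) powr (1 / p)"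
          by (intro \<Psi>_triangle sum_space_closed ss ws)
        then show ?thesis
          using \<Psi>_triangle[OF ss ws[of n], of j] unfolding \<Psi>_minus[OF ws] add_minus_cancel
            add.assoc right_minus add_0_right by linarith
      qed
      have "(\<lambda>n. \<Psi> j (w n) powr (1 / p)) \<longlonglongrightarrow> 0 powr (1 / p)"
        using \<Psi>w p_pos \<Psi>_nonneg[OF ws] by (intro tendsto_powr') auto
      then have lim: "(\<lambda>n. \<Psi> j (w n) powr (1 / p)) \<longlonglongrightarrow> 0"
        using p_pos by simp
      have "(\<lambda>n. \<Psi> j (s + w n) powr (1 / p) - \<Psi> j s powr (1 / p)) \<longlonglongrightarrow> 0"
        by (rule Lim_null_comparison[OF _ lim]) (simp add: bound)
      then have "(\<lambda>n. \<Psi> j (s + w n) powr (1 / p)) \<longlonglongrightarrow> \<Psi> j s powr (1 / p)"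
        by (rule LIM_zero_cancel)
      then have "(\<lambda>n. (\<Psi> j (s + w n) powr (1 / p)) powr p) \<longlonglongrightarrow> (\<Psi> j s powr (1 / p)) powr p"
        by (rule tendsto_powr'[OF _ tendsto_const]) (use p_pos in simp)
      then show ?thesis
        using p_pos \<Psi>_nonneg[OF sum_space_closed(2)[OF ss ws]] \<Psi>_nonneg[OF ss] by (simp add: powr_powr)
    qed
    then have "(\<lambda>n. \<Sum>j<J. \<Psi> j (s + w n)) \<longlonglongrightarrow> (\<Sum>j<J. \<Psi> j s)"
      by (intro tendsto_sum)
    then have "\<forall>\<^sub>F n in sequentially. (\<Sum>j<J. \<Psi> j (s + w n)) < (\<Sum>j<J. \<Psi> j s) + 1"
      by (rule order_tendstoD(2)) simp
    then obtain n where n: "(\<Sum>j<J. \<Psi> j (s + w n)) < (\<Sum>j<J. \<Psi> j s) + 1"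
      using eventually_happens'[OF sequentially_bot] by blast
    have sw: "s + w n \<in> lp_space"
      using s w by (intro lp_space_closed)
    note summ = lp_spaceD(2)[OF s] lp_spaceD(2)[OF w(1)[of n]] lp_spaceD(2)[OF sw]
    note tails = summ[THEN summable_ignore_initial_segment, of J]
    have "(\<Sum>i. \<Psi> (i + J) (s + w n)) \<le> (\<Sum>i. 2 powr p * (\<Psi> (i + J) s + \<Psi> (i + J) (w n)))"
      by (intro suminf_le \<Psi>_add_le summable_mult summable_add tails ss ws)
    also have "\<dots> = 2 powr p * ((\<Sum>i. \<Psi> (i + J) s) + (\<Sum>i. \<Psi> (i + J) (w n)))"
      using tails by (simp add: suminf_mult suminf_add summable_add)
    also have "\<dots> \<le> 2 powr p * (1 + 1)"
    proof (intro mult_left_mono add_mono)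
      have "(\<Sum>i. \<Psi> (i + J) (w n)) \<le> (\<Sum>i. \<Psi> (i + J) (w n)) + (\<Sum>i<J. \<Psi> i (w n))"
        using \<Psi>_nonneg[OF ws] by (simp add: sum_nonneg)
      also have "\<dots> = \<Phi> (w n)"
        unfolding \<Phi>_def by (rule suminf_split_initial_segment[OF summ(2), symmetric])
      finally show "(\<Sum>i. \<Psi> (i + J) (w n)) \<le> 1"
        by (simp add: \<Phi>w)
    qed (use J in auto)
    finally have "(\<Sum>i. \<Psi> (i + J) (s + w n)) \<le> 2 powr p * 2" by simp
    moreover have "\<Phi> (s + w n) = (\<Sum>i. \<Psi> (i + J) (s + w n)) + (\<Sum>j<J. \<Psi> j (s + w n))"
      unfolding \<Phi>_def by (rule suminf_split_initial_segment[OF summ(3)])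
    moreover have "(\<Sum>j<J. \<Psi> j s) \<le> \<Phi> s"
      using s by (intro sum_\<Psi>_le_\<Phi>) auto
    ultimately show ?thesis
      using n unfolding L_def by (intro exI[of _ n]) linarith
  qed
  have many: "\<exists>s\<in>lp_space. \<Phi> s \<le> L * real m \<and> \<eta> * real m \<le> R s" for m
  proof (induction m)
    case 0
    have "\<Phi> 0 = 0" by (simp add: \<Phi>_def \<Psi>_zero)
    moreover have "R 0 = 0"
      using R_scale[OF lp_space_closed(1), of 0] by simp
    ultimately show ?case
      using lp_space_closed(1) by (intro bexI[of _ 0]) auto
  next
    case (Suc m)
    then obtain s where s: "s \<in> lp_space" "\<Phi> s \<le> L * real m" "\<eta> * real m \<le> R s" by blast
    obtain n where n: "\<Phi> (s + w n) \<le> \<Phi> s + L" using step[OF s(1)] by blast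
    show ?case
      using s n Rw[of n] w(1)[of n]
      by (intro bexI[of _ "s + w n"] conjI) (auto simp: R_add algebra_simps intro: lp_space_closed)
  qed
  define K where "K = \<bar>C\<bar> * L powr (1 / p) / \<eta>"
  \<comment> \<open>Linear growth of \<open>R s\<close> against growth \<open>m powr (1 / p)\<close>
    of the norm would bound \<open>m powr q\<close>, although \<open>q\<close> is positive.\<close>
  define q where "q = 1 - 1 / p"
  have q: "0 < q" using p_gt_1 by (simp add: q_def)
  have K: "real m powr q \<le> K" if m: "0 < m" for m
  proof -
    obtain s where s: "s \<in> lp_space" "\<Phi> s \<le> L * real m" "\<eta> * real m \<le> R s"
      using many by blast
    have "\<eta> * real m \<le> \<bar>C\<bar> * lp_norm s"
      using s(3) C[OF s(1)] lp_norm_nonneg[of s] by (smt (verit) mult_right_mono)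
    also have "\<dots> \<le> \<bar>C\<bar> * (L * real m) powr (1 / p)"
      unfolding lp_norm_def using s \<Phi>_nonneg p_pos by (intro mult_left_mono powr_mono2) auto
    finally have "\<eta> * (real m powr q * real m powr (1 / p)) \<le> \<bar>C\<bar> * L powr (1 / p) * real m powr (1 / p)"
      using L m by (simp add: powr_mult q_def flip: powr_add)
    then have "\<eta> * real m powr q \<le> \<bar>C\<bar> * L powr (1 / p)"
      using m by (simp flip: mult.assoc)
    then show ?thesis
      unfolding K_def using \<eta> by (simp add: field_simps)
  qed
  obtain m where m: "max 1 ((K + 1) powr (1 / q)) < real m"
    using reals_Archimedean2 by blast
  have "0 \<le> K" using \<eta> by (simp add: K_def)
  have "((K + 1) powr (1 / q)) powr q < real m powr q"
    using m q by (intro powr_less_mono2) auto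
  then have "K + 1 < real m powr q"
    using q \<open>0 \<le> K\<close> by (simp add: powr_powr)
  moreover have "real m powr q \<le> K"
    using m by (intro K) auto
  ultimately show False by simp
qed

end

section \<open>Weak uniform rotundity of the discrete norm\<close>

context weighted_couple
begin

text \<open>The gap of the cost is the weighted sum of the gaps of \<open>N0 powr p\<close> and
  \<open>N1 powr p\<close>; the latter is nonnegative by convexity and is dropped.\<close>

lemma cost_gap:
  assumes "u \<in> B0" "v \<in> B0" "u' \<in> B1" "v' \<in> B1"
  shows "\<alpha> n powr p * ((N0 u powr p + N0 v powr p) / 2 - (N0 (u + v) / 2) powr p)
    \<le> (cost n u u' + cost n v v') / 2 - cost n (u + v) (u' + v') / 2 powr p"
proof -
  have split0: "(\<alpha> n * N0 x) powr p = \<alpha> n powr p * N0 x powr p" if "x \<in> B0" for x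
    using that weight_pos[of n] B0.norm_nonneg by (simp add: powr_mult)
  have split1: "(\<beta> n * N1 x) powr p = \<beta> n powr p * N1 x powr p" if "x \<in> B1" for x
    using that weight_pos[of n] B1.norm_nonneg by (simp add: powr_mult)
  have half0: "(N0 (u + v) / 2) powr p = N0 (u + v) powr p / 2 powr p"
    by (rule powr_divide)
  have half1: "(N1 (u' + v') / 2) powr p = N1 (u' + v') powr p / 2 powr p"
    by (rule powr_divide)
  have "0 \<le> \<beta> n powr p * ((N1 u' powr p + N1 v' powr p) / 2 - (N1 (u' + v') / 2) powr p)"
    using B1.norm_powr_midpoint[OF p_ge_1 assms(3,4)] by (intro mult_nonneg_nonneg) auto
  then show ?thesis
    unfolding cost_def half0 half1 split0[OF assms(1)] split0[OF assms(2)] split1[OF assms(3)]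
      split1[OF assms(4)] split0[OF B0.carrier_closed(2)[OF assms(1,2)]]
      split1[OF B1.carrier_closed(2)[OF assms(3,4)]]
    by (simp add: algebra_simps add_divide_distrib diff_divide_distrib)
qed

text \<open>The choices are nested: \<open>\<eta>\<close> determines \<open>M\<close> and
  \<open>g\<close>, these determine \<open>k\<close>, and only \<open>n\<close> tends to infinity.
  With \<open>k\<close> fixed, the bound \<open>2 / \<alpha> k\<close> for the
  \<open>B0\<close>-parts is uniform in \<open>n\<close>.\<close>

lemma real_functional_tendsto_0:
  assumes wur: "weakly_uniformly_rotund scl B0 N0" and unbounded: "\<And>K. \<exists>n. K < \<beta> n"
    and R: "linear_on_set rscale lp_space R" and C: "\<And>x. x \<in> lp_space \<Longrightarrow> \<bar>R x\<bar> \<le> C * lp_norm x"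
    and x: "\<And>n. x n \<in> lp_space" "\<And>n. lp_norm (x n) = 1"
    and y: "\<And>n. y n \<in> lp_space" "\<And>n. lp_norm (y n) = 1"
    and lim: "(\<lambda>n. lp_norm (x n + y n)) \<longlonglongrightarrow> 2"
  shows "(\<lambda>n. R (x n - y n)) \<longlonglongrightarrow> 0"
proof (rule tendstoI, unfold dist_real_def diff_0_right)
  fix e :: real assume e: "0 < e"
  have lp_real: "module.subspace rscale lp_space"
    by (rule real_subspace[OF vs lp_space_subspace])
  \<comment> \<open>The final error is \<open>2 * \<eta>\<close> from replacing \<open>R\<close> by
    \<open>g\<close> on \<open>x n - y n\<close>, whose norm is at most 2, plus
    \<open>\<eta>\<close> from the \<open>B1\<close>-parts and \<open>e / 8\<close> from the
    \<open>B0\<close>-parts.\<close>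
  define \<eta> where "\<eta> = e / 8"
  have \<eta>: "0 < \<eta>" using e by (simp add: \<eta>_def)
  obtain M where M: "0 \<le> M" "\<And>x. x \<in> lp_space \<Longrightarrow> \<bar>R x\<bar> \<le> \<eta> * lp_norm x + M * sum_norm x"
    using functional_le_small_plus_sum_norm[OF R C \<eta>] by blast
  have sn1: "seminorm_on rscale lp_space (\<lambda>x. \<eta> * lp_norm x)"
    unfolding seminorm_on_def distrib_left[symmetric]
    using \<eta> by (auto simp: lp_norm_scale intro!: mult_left_mono lp_norm_triangle)
  have sn2: "seminorm_on rscale sum_space (\<lambda>x. M * sum_norm x)"
    unfolding seminorm_on_def distrib_left[symmetric]
    using M(1) by (auto simp: sum_norm_scale intro!: mult_left_mono sum_norm_triangle)
  have sub: "lp_space \<subseteq> sum_space"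
    using lp_spaceD(1) by blast
  obtain g where g: "linear_on_set rscale sum_space g"
    "\<And>x. x \<in> sum_space \<Longrightarrow> \<bar>g x\<bar> \<le> M * sum_norm x"
    "\<And>x. x \<in> lp_space \<Longrightarrow> \<bar>R x - g x\<bar> \<le> \<eta> * lp_norm x"
    using linear_on_set_approx_extension[OF real_vs real_subspace[OF vs sum_space_subspace] lp_real
        sub R sn1 sn2 M(2)] by blast
  \<comment> \<open>Each \<open>B1\<close>-part will have norm at most \<open>2 / \<beta> k\<close>,
    so \<open>g\<close> is at most \<open>M * \<beta> 0 * (4 / \<beta> k)\<close> on their
    difference; this choice brings that below \<open>\<eta>\<close>.\<close>
  obtain k where k: "4 * M * \<beta> 0 / \<eta> < \<beta> k"
    using unbounded by blast
  have xs: "x n \<in> sum_space" "y n \<in> sum_space" "x n + y n \<in> sum_space" for n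
    using x(1) y(1) sub lp_space_closed(2) by blast+
  have \<Phi>1: "\<Phi> (x n) = 1" "\<Phi> (y n) = 1" for n
    using lp_norm_powr[OF x(1)[of n]] lp_norm_powr[OF y(1)[of n]] x(2) y(2) by simp_all
  have approx: "\<exists>u u'. u \<in> B0 \<and> u' \<in> B1 \<and> z n = u + u' \<and>
      cost k u u' < \<Psi> k (z n) + inverse (real (Suc n))" if "\<And>n. z n \<in> sum_space" for z n
    by (rule \<Psi>_approx[OF that, of k n "\<Psi> k (z n) + inverse (real (Suc n))"]) auto
  obtain u u' where u: "\<And>n. u n \<in> B0" "\<And>n. u' n \<in> B1" "\<And>n. x n = u n + u' n"
    "\<And>n. cost k (u n) (u' n) < \<Psi> k (x n) + inverse (real (Suc n))"
    using approx[of x, OF xs(1)] by metis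
  obtain v v' where v: "\<And>n. v n \<in> B0" "\<And>n. v' n \<in> B1" "\<And>n. y n = v n + v' n"
    "\<And>n. cost k (v n) (v' n) < \<Psi> k (y n) + inverse (real (Suc n))"
    using approx[of y, OF xs(2)] by metis
  \<comment> \<open>Since \<open>\<Psi> k z \<le> \<Phi> z = 1\<close> and the error is at most 1,
    the cost stays below \<open>2 \<le> 2 powr p\<close>.\<close>
  have cost_bound: "\<alpha> k * N0 a \<le> 2 \<and> \<beta> k * N1 b \<le> 2"
    if "cost k a b < \<Psi> k z + inverse (real (Suc n))" "z \<in> lp_space" "\<Phi> z = 1" for a b z n
  proof -
    have "inverse (real (Suc n)) \<le> 1"
      by (simp add: field_simps)
    then have "cost k a b < 2"
      using that \<Psi>_le_\<Phi>[OF that(2), of k] by linarith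
    also have "2 \<le> 2 powr p"
      using powr_mono[of 1 p 2] p_ge_1 by simp
    finally have "(\<alpha> k * N0 a) powr p < 2 powr p" "(\<beta> k * N1 b) powr p < 2 powr p"
      using powr_ge_zero[of "\<alpha> k * N0 a" p] powr_ge_zero[of "\<beta> k * N1 b" p]
      unfolding cost_def by linarith+
    then show ?thesis
      using powr_less_imp_less p_pos by (simp add: less_imp_le)
  qed
  have ub: "\<alpha> k * N0 (u n) \<le> 2" "\<beta> k * N1 (u' n) \<le> 2" for n
    using cost_bound[OF u(4) x(1) \<Phi>1(1)] by auto
  have vb: "\<alpha> k * N0 (v n) \<le> 2" "\<beta> k * N1 (v' n) \<le> 2" for n
    using cost_bound[OF v(4) y(1) \<Phi>1(2)] by auto
  define G where "G n = (N0 (u n) powr p + N0 (v n) powr p) / 2 - (N0 (u n + v n) / 2) powr p" for n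
  have gap: "\<alpha> k powr p * G n \<le> (1 - (lp_norm (x n + y n) / 2) powr p) + inverse (real (Suc n))" for n
  proof -
    \<comment> \<open>The terms of a nonnegative series with sum
      \<open>1 - (lp_norm (x n + y n) / 2) powr p\<close>; a single term is bounded by the
      sum.\<close>
    define D where "D j = (\<Psi> j (x n) + \<Psi> j (y n)) / 2 - \<Psi> j (x n + y n) / 2 powr p" for j
    have "\<Psi> k (x n + y n) \<le> cost k (u n + v n) (u' n + v' n)"
    proof -
      have "x n + y n = (u n + v n) + (u' n + v' n)"
        using u(3)[of n] v(3)[of n] by (simp add: algebra_simps)
      then show ?thesis
        using u v by (simp only:) (intro \<Psi>_le B0.carrier_closed B1.carrier_closed)
    qed
    then have "\<Psi> k (x n + y n) / 2 powr p \<le> cost k (u n + v n) (u' n + v' n) / 2 powr p"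
      by (intro divide_right_mono) auto
    moreover have "(cost k (u n) (u' n) + cost k (v n) (v' n)) / 2 \<le>
        (\<Psi> k (x n) + \<Psi> k (y n)) / 2 + inverse (real (Suc n))"
      using u(4)[of n] v(4)[of n] unfolding add_divide_distrib by linarith
    ultimately have 1: "\<alpha> k powr p * G n \<le> D k + inverse (real (Suc n))"
      unfolding G_def D_def diff_add_eq by (intro order_trans[OF cost_gap[OF u(1) v(1) u(2) v(2)] diff_mono])
    have Dnn: "0 \<le> D j" for j
      unfolding D_def using \<Psi>_midpoint[OF xs(1,2)] by simp
    note summ = lp_spaceD(2)[OF x(1)[of n]] lp_spaceD(2)[OF y(1)[of n]]
      lp_spaceD(2)[OF lp_space_closed(2)[OF x(1)[of n] y(1)[of n]]]
    have "D sums ((\<Phi> (x n) + \<Phi> (y n)) / 2 - \<Phi> (x n + y n) / 2 powr p)"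
      unfolding D_def[abs_def] \<Phi>_def
      by (intro sums_diff sums_divide sums_add summable_sums summ)
    then have D: "summable D" "suminf D = 1 - \<Phi> (x n + y n) / 2 powr p"
      by (auto simp: sums_iff \<Phi>1)
    have "D k \<le> suminf D"
      using sum_le_suminf[OF D(1), of "{k}"] Dnn by simp
    also have "\<dots> = 1 - (lp_norm (x n + y n) / 2) powr p"
      unfolding D(2) using lp_norm_powr[OF lp_space_closed(2)[OF x(1) y(1)]]
      by (simp add: powr_divide lp_norm_nonneg)
    finally show ?thesis
      using 1 by linarith
  qed
  have Gnn: "0 \<le> G n" for n
    unfolding G_def using B0.norm_powr_midpoint[OF p_ge_1 u(1) v(1)] by simp
  have \<alpha>k: "0 < \<alpha> k powr p"
    using weight_pos[of k] by simp
  have "(\<lambda>n. (1 - (lp_norm (x n + y n) / 2) powr p) + inverse (real (Suc n))) \<longlonglongrightarrow> (1 - (2 / 2) powr p) + 0"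
    by (intro tendsto_intros lim LIMSEQ_inverse_real_of_nat) auto
  then have lim0: "(\<lambda>n. (1 - (lp_norm (x n + y n) / 2) powr p) + inverse (real (Suc n))) \<longlonglongrightarrow> 0"
    by simp
  have "0 \<le> \<alpha> k powr p * G n" for n
    using Gnn[of n] by simp
  then have "(\<lambda>n. \<alpha> k powr p * G n) \<longlonglongrightarrow> 0"
    by (intro tendsto_sandwich[OF always_eventually always_eventually tendsto_const lim0] allI gap)
  then have "(\<lambda>n. \<alpha> k powr p * G n / \<alpha> k powr p) \<longlonglongrightarrow> 0 / \<alpha> k powr p"
    by (rule tendsto_divide[OF _ tendsto_const]) (use \<alpha>k in simp)
  then have G0: "G \<longlonglongrightarrow> 0"
    using \<alpha>k by simp
  have gB0: "linear_on_set rscale B0 g"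
    by (rule linear_on_set_subset[OF g(1) carrier_le_sum_space(1)])
  have gbound: "\<bar>g a\<bar> \<le> (M * \<alpha> 0) * N0 a" if "a \<in> B0" for a
  proof -
    have "\<bar>g a\<bar> \<le> M * sum_norm a"
      using that carrier_le_sum_space by (intro g) auto
    also have "\<dots> \<le> M * (\<alpha> 0 * N0 a)"
      using M(1) sum_norm_le_0[OF that] by (intro mult_left_mono)
    finally show ?thesis by simp
  qed
  \<comment> \<open>Rotundity of \<open>B0\<close> is tested by complex functionals;
    \<open>g\<close> is recovered below as the real part.\<close>
  have fg: "(\<lambda>a. Complex (g a) (- g (scl \<i> a))) \<in> bounded_functionals scl B0 N0"
    by (rule real_functional_complexify[OF vs B0.subspace_carrier gB0 gbound])
      (simp_all add: B0.norm_scale)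
  have "(\<lambda>n. Complex (g (u n - v n)) (- g (scl \<i> (u n - v n)))) \<longlonglongrightarrow> 0"
  proof (rule weakly_uniformly_rotund_powr_gap[OF wur fg p_gt_1 u(1) _ v(1) _ G0[unfolded G_def[abs_def]]])
    show "N0 (u n) \<le> 2 / \<alpha> k" "N0 (v n) \<le> 2 / \<alpha> k" for n
      using ub(1)[of n] vb(1)[of n] weight_pos[of k] by (simp_all add: field_simps)
  qed
  from tendsto_Re[OF this] have "(\<lambda>n. g (u n - v n)) \<longlonglongrightarrow> 0"
    by simp
  from tendstoD[OF this, of "e / 8"] have "\<forall>\<^sub>F n in sequentially. \<bar>g (u n - v n)\<bar> < e / 8"
    using e by (simp add: dist_real_def)
  then show "\<forall>\<^sub>F n in sequentially. \<bar>R (x n - y n)\<bar> < e"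
  proof (rule eventually_mono)
    fix n assume n: "\<bar>g (u n - v n)\<bar> < e / 8"
    have in_B: "u n - v n \<in> B0" "u' n - v' n \<in> B1"
      using u v by (auto intro: B0.carrier_closed B1.carrier_closed)
    have "x n - y n = (u n - v n) + (u' n - v' n)"
      using u(3)[of n] v(3)[of n] by (simp add: algebra_simps)
    then have "g (x n - y n) = g (u n - v n) + g (u' n - v' n)"
      using g(1) in_B carrier_le_sum_space unfolding linear_on_set_def by auto
    moreover have "\<bar>g (u' n - v' n)\<bar> \<le> \<eta>"
    proof -
      have "\<bar>g (u' n - v' n)\<bar> \<le> M * sum_norm (u' n - v' n)"
        using in_B carrier_le_sum_space by (intro g) auto
      also have "\<dots> \<le> M * (\<beta> 0 * N1 (u' n - v' n))"
        using M(1) sum_norm_le_1[OF in_B(2)] by (intro mult_left_mono)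
      also have "\<dots> \<le> M * (\<beta> 0 * (4 / \<beta> k))"
      proof -
        have "N1 (u' n - v' n) \<le> N1 (u' n) + N1 (v' n)"
          by (rule B1.norm_triangle_diff[OF u(2) v(2)])
        also have "\<dots> \<le> 2 / \<beta> k + 2 / \<beta> k"
          using ub(2)[of n] vb(2)[of n] weight_pos[of k] by (intro add_mono) (simp_all add: field_simps)
        finally show ?thesis
          using M(1) weight_pos[of 0] by (intro mult_left_mono) auto
      qed
      also have "\<dots> \<le> \<eta>"
        using k weight_pos[of k] \<eta> by (simp add: field_simps)
      finally show ?thesis .
    qed
    moreover have "\<bar>R (x n - y n) - g (x n - y n)\<bar> \<le> \<eta> * 2"
    proof -
      have "\<bar>R (x n - y n) - g (x n - y n)\<bar> \<le> \<eta> * lp_norm (x n - y n)"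
        using x y by (intro g lp_space_closed)
      also have "lp_norm (x n - y n) \<le> 2"
        using complex_normed_space.norm_triangle_diff[OF lp_complex_normed_space x(1) y(1), of n n] x(2) y(2)
        by simp
      finally show ?thesis using \<eta> by simp
    qed
    ultimately show "\<bar>R (x n - y n)\<bar> < e"
      using n e unfolding \<eta>_def by linarith
  qed
qed

theorem lp_weakly_uniformly_rotund:
  assumes wur: "weakly_uniformly_rotund scl B0 N0" and unbounded: "\<And>K. \<exists>n. K < \<beta> n"
  shows "weakly_uniformly_rotund scl lp_space lp_norm"
  unfolding weakly_uniformly_rotund_def
proof (intro conjI allI impI)
  fix x y :: "nat \<Rightarrow> 'v"
  assume x: "\<forall>n. x n \<in> lp_space \<and> lp_norm (x n) = 1" and y: "\<forall>n. y n \<in> lp_space \<and> lp_norm (y n) = 1"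
    and lim: "(\<lambda>n. lp_norm (x n + y n)) \<longlonglongrightarrow> 2"
  show "limitin (weak_topology scl lp_space lp_norm) (\<lambda>n. x n - y n) 0 sequentially"
  proof (rule limitin_weak_topologyI)
    fix f assume f: "f \<in> bounded_functionals scl lp_space lp_norm"
    then obtain C where C: "\<And>x. x \<in> lp_space \<Longrightarrow> cmod (f x) \<le> C * lp_norm x"
      unfolding bounded_functionals_def by blast
    have add: "f (a + b) = f a + f b" and scale: "f (scl c a) = c * f a"
      if "a \<in> lp_space" "b \<in> lp_space" for a b c
      using f that unfolding bounded_functionals_def by blast+
    have "f 0 = 0"
      using add[OF lp_space_closed(1) lp_space_closed(1)] by simp
    have "(\<lambda>n. Re (f (x n - y n))) \<longlonglongrightarrow> 0"
    proof (rule real_functional_tendsto_0[OF wur unbounded _ _ _ _ _ _ lim])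
      show "linear_on_set rscale lp_space (\<lambda>x. Re (f x))"
        by (auto simp: linear_on_set_def add scale)
      show "\<bar>Re (f x)\<bar> \<le> C * lp_norm x" if "x \<in> lp_space" for x
        using C[OF that] abs_Re_le_cmod order_trans by blast
    qed (use x y in auto)
    moreover have "(\<lambda>n. Im (f (x n - y n))) \<longlonglongrightarrow> 0"
    proof (rule real_functional_tendsto_0[OF wur unbounded _ _ _ _ _ _ lim])
      show "linear_on_set rscale lp_space (\<lambda>x. Im (f x))"
        by (auto simp: linear_on_set_def add scale)
      show "\<bar>Im (f x)\<bar> \<le> C * lp_norm x" if "x \<in> lp_space" for x
        using C[OF that] abs_Im_le_cmod order_trans by blast
    qed (use x y in auto)
    ultimately show "(\<lambda>n. f (x n - y n)) \<longlonglongrightarrow> f 0"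
      unfolding \<open>f 0 = 0\<close> tendsto_complex_iff by simp
  qed (use x y lp_space_closed in auto)
qed (rule lp_complex_Banach_space)

end

section \<open>Comparison with the K-method\<close>

definition dyadic :: "nat \<Rightarrow> real" where
  "dyadic n = 2 powr real_of_int (int_decode n)"

text \<open>Half-open, so that every positive \<open>t\<close> lies in exactly one interval.\<close>

definition dyadic_interval :: "nat \<Rightarrow> real set" where
  "dyadic_interval n = {dyadic n..<2 * dyadic n}"

lemma dyadic_pos: "0 < dyadic n"
  by (simp add: dyadic_def)

lemma dyadic_interval_iff:
  "t \<in> dyadic_interval n \<longleftrightarrow> 0 < t \<and> \<lfloor>log 2 t\<rfloor> = int_decode n"
proof (cases "0 < t")
  case True
  have "2 * dyadic n = 2 powr (real_of_int (int_decode n) + 1)"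
    by (simp add: dyadic_def powr_add)
  then show ?thesis
    using True by (simp add: dyadic_interval_def dyadic_def floor_eq_iff le_log_iff log_less_iff)
next
  case False
  then show ?thesis
    using dyadic_pos[of n] by (auto simp: dyadic_interval_def)
qed

lemma disjoint_family_dyadic_interval: "disjoint_family dyadic_interval"
  unfolding disjoint_family_on_def
  by (metis dyadic_interval_iff disjoint_iff int_decode_inverse)

text \<open>The divisor cancels the length \<open>dyadic n\<close> of the interval; it is the
  discrete substitute for the factor \<open>1 / t\<close> of the measure.\<close>

lemma nn_integral_dyadic_step:
  assumes "\<And>n. 0 \<le> c n"
  shows "(\<integral>\<^sup>+t. (\<Sum>n. ennreal (c n / dyadic n) * indicator (dyadic_interval n) t) \<partial>lborel) =
    (\<Sum>n. ennreal (c n))"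
proof -
  have "(\<integral>\<^sup>+t. ennreal (c n / dyadic n) * indicator (dyadic_interval n) t \<partial>lborel) = ennreal (c n)" for n
    using dyadic_pos[of n] assms[of n]
    by (simp add: nn_integral_cmult_indicator dyadic_interval_def flip: ennreal_mult)
  then show ?thesis
    by (subst nn_integral_suminf) (auto simp: dyadic_interval_def)
qed

locale real_interpolation = interpolation_couple scl B0 N0 B1 N1
  for scl :: "complex \<Rightarrow> 'v::{topological_ab_group_add, t2_space} \<Rightarrow> 'v"
    and B0 :: "'v set" and N0 :: "'v \<Rightarrow> real" and B1 :: "'v set" and N1 :: "'v \<Rightarrow> real" +
  fixes \<theta> p :: real
  assumes \<theta>_pos: "0 < \<theta>" and \<theta>_less_1: "\<theta> < 1" and exponent_gt_1: "1 < p"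

text \<open>These are the coefficients of \<open>N0 a\<close> and \<open>N1 b\<close> in
  \<open>t powr (- \<theta>) * (N0 a + t * N1 b)\<close> at \<open>t = dyadic n\<close>.\<close>

sublocale real_interpolation \<subseteq>
  weighted_couple scl B0 N0 B1 N1 "\<lambda>n. dyadic n powr (- \<theta>)" "\<lambda>n. dyadic n powr (1 - \<theta>)" p
  by unfold_locales (simp_all add: dyadic_pos exponent_gt_1 dyadic_pos[THEN less_imp_neq, symmetric])

context real_interpolation
begin

text \<open>On the interval, \<open>t\<close> and \<open>dyadic n\<close> differ by a factor of at
  most 2, and both exponents have absolute value below 1, so each weight changes by a factor of at
  most 2.\<close>

lemma weights_comparable:
  assumes t: "t \<in> dyadic_interval n" and rs: "0 \<le> r" "0 \<le> s"
  shows "t powr (- \<theta>) * (r + t * s) \<le> 2 * (dyadic n powr (- \<theta>) * r + dyadic n powr (1 - \<theta>) * s)"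
    and "dyadic n powr (- \<theta>) * r + dyadic n powr (1 - \<theta>) * s \<le> 2 * (t powr (- \<theta>) * (r + t * s))"
proof -
  have d: "0 < dyadic n" "dyadic n \<le> t" "t \<le> 2 * dyadic n" "0 < t"
    using t dyadic_pos[of n] by (auto simp: dyadic_interval_def)
  have eq: "t powr (- \<theta>) * (r + t * s) = t powr (- \<theta>) * r + t powr (1 - \<theta>) * s"
    using d powr_mult_base[of t "- \<theta>"] by (simp add: algebra_simps)
  have up0: "t powr (- \<theta>) \<le> dyadic n powr (- \<theta>)"
    using d \<theta>_pos by (intro powr_mono2') auto
  have "t powr (1 - \<theta>) \<le> (2 * dyadic n) powr (1 - \<theta>)"
    using d \<theta>_less_1 by (intro powr_mono2) auto
  also have "\<dots> \<le> 2 * dyadic n powr (1 - \<theta>)"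
    using d \<theta>_pos powr_mono[of "1 - \<theta>" 1 2] by (simp add: powr_mult mult_right_mono)
  finally have up1: "t powr (1 - \<theta>) \<le> 2 * dyadic n powr (1 - \<theta>)" .
  have "2 powr (-1) * dyadic n powr (- \<theta>) \<le> 2 powr (- \<theta>) * dyadic n powr (- \<theta>)"
    using \<theta>_less_1 by (intro mult_right_mono powr_mono) auto
  also have "\<dots> = (2 * dyadic n) powr (- \<theta>)"
    using d by (simp add: powr_mult)
  also have "\<dots> \<le> t powr (- \<theta>)"
    using d \<theta>_pos by (intro powr_mono2') auto
  finally have low0: "dyadic n powr (- \<theta>) \<le> 2 * t powr (- \<theta>)"
    by (simp add: powr_minus)
  have low1: "dyadic n powr (1 - \<theta>) \<le> t powr (1 - \<theta>)"
    using d \<theta>_less_1 by (intro powr_mono2) auto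
  have nn: "0 \<le> dyadic n powr (- \<theta>) * r" "0 \<le> t powr (1 - \<theta>) * s"
    using rs by auto
  show "t powr (- \<theta>) * (r + t * s) \<le> 2 * (dyadic n powr (- \<theta>) * r + dyadic n powr (1 - \<theta>) * s)"
    using mult_right_mono[OF up0 rs(1)] mult_right_mono[OF up1 rs(2)] nn unfolding eq
    by (simp add: algebra_simps)
  show "dyadic n powr (- \<theta>) * r + dyadic n powr (1 - \<theta>) * s \<le> 2 * (t powr (- \<theta>) * (r + t * s))"
    using mult_right_mono[OF low0 rs(1)] mult_right_mono[OF low1 rs(2)] nn unfolding eq
    by (simp add: algebra_simps)
qed

lemma K_functional_le:
  assumes "a \<in> B0" "b \<in> B1" "0 \<le> t"
  shows "K_functional B0 N0 B1 N1 t (a + b) \<le> N0 a + t * N1 b"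
  unfolding K_functional_def using assms
  by (intro cInf_lower bdd_belowI[of _ 0])
    (auto intro!: add_nonneg_nonneg mult_nonneg_nonneg B0.norm_nonneg B1.norm_nonneg)

lemma K_functional_greatest:
  assumes "x \<in> sum_space" "\<And>a b. a \<in> B0 \<Longrightarrow> b \<in> B1 \<Longrightarrow> x = a + b \<Longrightarrow> c \<le> N0 a + t * N1 b"
  shows "c \<le> K_functional B0 N0 B1 N1 t x"
  unfolding K_functional_def using assms by (intro cInf_greatest) (auto simp: sum_space_def)

lemma K_functional_nonneg: "x \<in> sum_space \<Longrightarrow> 0 \<le> t \<Longrightarrow> 0 \<le> K_functional B0 N0 B1 N1 t x"
  by (rule K_functional_greatest)
    (auto intro!: add_nonneg_nonneg mult_nonneg_nonneg B0.norm_nonneg B1.norm_nonneg)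

text \<open>Of \<open>4 powr p\<close>, one factor \<open>2 powr p\<close> stems from the weights
  and the other from \<open>powr_add_le\<close>. In the converse direction superadditivity costs
  nothing, which leaves \<open>2 powr p\<close>.\<close>

lemma K_functional_comparable:
  assumes t: "t \<in> dyadic_interval n" and x: "x \<in> sum_space"
  shows "(t powr (- \<theta>) * K_functional B0 N0 B1 N1 t x) powr p \<le> 4 powr p * \<Psi> n x"
    and "\<Psi> n x \<le> 2 powr p * (t powr (- \<theta>) * K_functional B0 N0 B1 N1 t x) powr p"
proof -
  define K where "K = K_functional B0 N0 B1 N1 t x"
  have t0: "0 < t"
    using t dyadic_interval_iff by blast
  have K0: "0 \<le> K"
    unfolding K_def using x t0 by (intro K_functional_nonneg) auto
  have "(t powr (- \<theta>) * K) powr p / 4 powr p \<le> \<Psi> n x"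
  proof (rule \<Psi>_greatest[OF x])
    fix a b assume ab: "a \<in> B0" "b \<in> B1" "x = a + b"
    define r s where "r = dyadic n powr (- \<theta>) * N0 a" and "s = dyadic n powr (1 - \<theta>) * N1 b"
    have rs: "0 \<le> r" "0 \<le> s"
      using ab B0.norm_nonneg B1.norm_nonneg by (auto simp: r_def s_def)
    have "t powr (- \<theta>) * K \<le> t powr (- \<theta>) * (N0 a + t * N1 b)"
      unfolding K_def ab(3) using ab t0 by (intro mult_left_mono K_functional_le) auto
    also have "\<dots> \<le> 2 * (r + s)"
      unfolding r_def s_def using ab B0.norm_nonneg B1.norm_nonneg by (intro weights_comparable t) auto
    finally have "(t powr (- \<theta>) * K) powr p \<le> (2 * (r + s)) powr p"
      using K0 p_pos by (intro powr_mono2) auto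
    also have "\<dots> = 2 powr p * (r + s) powr p"
      by (rule powr_mult)
    also have "\<dots> \<le> 2 powr p * (2 powr p * (r powr p + s powr p))"
      using rs p_ge_1 by (intro mult_left_mono powr_add_le) auto
    also have "\<dots> = 4 powr p * cost n a b"
      using powr_mult[of 2 2 p] by (simp add: cost_def r_def s_def)
    finally show "(t powr (- \<theta>) * K) powr p / 4 powr p \<le> cost n a b"
      by (simp add: field_simps)
  qed
  then show "(t powr (- \<theta>) * K_functional B0 N0 B1 N1 t x) powr p \<le> 4 powr p * \<Psi> n x"
    unfolding K_def by (simp add: field_simps)
  have "\<Psi> n x powr (1 / p) / (2 * t powr (- \<theta>)) \<le> K"
    unfolding K_def
  proof (rule K_functional_greatest[OF x])
    fix a b assume ab: "a \<in> B0" "b \<in> B1" "x = a + b"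
    define r s where "r = dyadic n powr (- \<theta>) * N0 a" and "s = dyadic n powr (1 - \<theta>) * N1 b"
    have rs: "0 \<le> r" "0 \<le> s"
      using ab B0.norm_nonneg B1.norm_nonneg by (auto simp: r_def s_def)
    have "\<Psi> n x \<le> r powr p + s powr p"
      using \<Psi>_le[OF ab(1,2), of n] by (simp add: cost_def r_def s_def ab(3))
    also have "\<dots> \<le> (r + s) powr p"
      using rs p_ge_1 by (intro powr_add_superadditive)
    finally have "\<Psi> n x powr (1 / p) \<le> ((r + s) powr p) powr (1 / p)"
      using p_pos \<Psi>_nonneg[OF x] by (intro powr_mono2) auto
    also have "\<dots> = r + s"
      using p_pos rs by (simp add: powr_powr)
    also have "\<dots> \<le> 2 * (t powr (- \<theta>) * (N0 a + t * N1 b))"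
      unfolding r_def s_def using ab B0.norm_nonneg B1.norm_nonneg by (intro weights_comparable t) auto
    finally show "\<Psi> n x powr (1 / p) / (2 * t powr (- \<theta>)) \<le> N0 a + t * N1 b"
      using t0 by (simp add: divide_le_eq mult.commute mult.left_commute)
  qed
  then have "\<Psi> n x powr (1 / p) \<le> 2 * (t powr (- \<theta>) * K)"
    using t0 by (simp add: divide_le_eq mult.commute mult.left_commute)
  then have "(\<Psi> n x powr (1 / p)) powr p \<le> (2 * (t powr (- \<theta>) * K)) powr p"
    using p_pos by (intro powr_mono2) auto
  also have "\<dots> = 2 powr p * (t powr (- \<theta>) * K) powr p"
    by (rule powr_mult)
  finally show "\<Psi> n x \<le> 2 powr p * (t powr (- \<theta>) * K_functional B0 N0 B1 N1 t x) powr p"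
    using p_pos \<Psi>_nonneg[OF x] by (simp add: powr_powr K_def)
qed

text \<open>The integrand is squeezed pointwise between two dyadic step functions. The additional
  factor 2 in the lower bound comes from \<open>1 / t \<ge> 1 / (2 * dyadic n)\<close>.\<close>

lemma real_interp_integral_comparable:
  assumes x: "x \<in> sum_space"
  shows "real_interp_integral B0 N0 B1 N1 \<theta> p x \<le> (\<Sum>n. ennreal (4 powr p * \<Psi> n x))"
    and "(\<Sum>n. ennreal (\<Psi> n x / (2 * 2 powr p))) \<le> real_interp_integral B0 N0 B1 N1 \<theta> p x"
proof -
  define H where "H t = (t powr (- \<theta>) * K_functional B0 N0 B1 N1 t x) powr p / t" for t
  have int: "real_interp_integral B0 N0 B1 N1 \<theta> p x = (\<integral>\<^sup>+t. ennreal (H t) * indicator {0<..} t \<partial>lborel)"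
    by (simp add: real_interp_integral_def H_def)
  have ex: "\<exists>n. t \<in> dyadic_interval n" if "0 < t" for t
    using that by (intro exI[of _ "int_encode \<lfloor>log 2 t\<rfloor>"]) (simp add: dyadic_interval_iff)
  note step = suminf_cmult_indicator[OF disjoint_family_dyadic_interval]
  have "ennreal (H t) * indicator {0<..} t \<le>
      (\<Sum>n. ennreal (4 powr p * \<Psi> n x / dyadic n) * indicator (dyadic_interval n) t)" for t
  proof (cases "0 < t")
    case True
    then obtain n where n: "t \<in> dyadic_interval n" using ex by blast
    have "H t \<le> 4 powr p * \<Psi> n x / dyadic n"
      unfolding H_def using K_functional_comparable(1)[OF n x] n dyadic_pos[of n] \<Psi>_nonneg[OF x]
      by (intro frac_le) (auto simp: dyadic_interval_def)
    then show ?thesis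
      using True by (simp add: step[OF n] ennreal_leI)
  qed simp
  then show "real_interp_integral B0 N0 B1 N1 \<theta> p x \<le> (\<Sum>n. ennreal (4 powr p * \<Psi> n x))"
    unfolding int using \<Psi>_nonneg[OF x]
    by (subst nn_integral_dyadic_step[symmetric]) (auto intro: nn_integral_mono)
  have "(\<Sum>n. ennreal (\<Psi> n x / (2 * 2 powr p) / dyadic n) * indicator (dyadic_interval n) t)
      \<le> ennreal (H t) * indicator {0<..} t" for t
  proof (cases "0 < t")
    case True
    then obtain n where n: "t \<in> dyadic_interval n" using ex by blast
    have "\<Psi> n x / (2 * 2 powr p) / dyadic n = (\<Psi> n x / 2 powr p) / (2 * dyadic n)"
      by simp
    also have "\<dots> \<le> H t"
      unfolding H_def using K_functional_comparable(2)[OF n x] n True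
      by (intro frac_le) (auto simp: dyadic_interval_def field_simps)
    finally show ?thesis
      using True by (simp add: step[OF n] ennreal_leI)
  next
    case False
    then have "t \<notin> dyadic_interval n" for n
      by (simp add: dyadic_interval_iff)
    then show ?thesis by simp
  qed
  then show "(\<Sum>n. ennreal (\<Psi> n x / (2 * 2 powr p))) \<le> real_interp_integral B0 N0 B1 N1 \<theta> p x"
    unfolding int using \<Psi>_nonneg[OF x]
    by (subst nn_integral_dyadic_step[symmetric]) (auto intro: nn_integral_mono)
qed

section \<open>Identification with the real interpolation space\<close>

lemma real_interp_integral_lp_space:
  assumes x: "x \<in> lp_space"
  shows "real_interp_integral B0 N0 B1 N1 \<theta> p x \<le> ennreal (4 powr p * \<Phi> x)"
    and "ennreal (\<Phi> x / (2 * 2 powr p)) \<le> real_interp_integral B0 N0 B1 N1 \<theta> p x"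
proof -
  note xD = lp_spaceD[OF x]
  have "(\<Sum>n. ennreal (4 powr p * \<Psi> n x)) = ennreal (4 powr p * \<Phi> x)"
    unfolding \<Phi>_def using xD \<Psi>_nonneg by (simp add: suminf_ennreal2 summable_mult suminf_mult)
  then show "real_interp_integral B0 N0 B1 N1 \<theta> p x \<le> ennreal (4 powr p * \<Phi> x)"
    using real_interp_integral_comparable(1)[OF xD(1)] by simp
  have "(\<Sum>n. ennreal (\<Psi> n x / (2 * 2 powr p))) = ennreal (\<Phi> x / (2 * 2 powr p))"
    unfolding \<Phi>_def using xD \<Psi>_nonneg by (simp add: suminf_ennreal2 summable_divide suminf_divide)
  then show "ennreal (\<Phi> x / (2 * 2 powr p)) \<le> real_interp_integral B0 N0 B1 N1 \<theta> p x"
    using real_interp_integral_comparable(2)[OF xD(1)] by simp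
qed

lemma real_interp_space_eq: "real_interp_space B0 N0 B1 N1 \<theta> p = lp_space"
proof (intro equalityI subsetI)
  fix x assume "x \<in> real_interp_space B0 N0 B1 N1 \<theta> p"
  then have x: "x \<in> sum_space" and fin: "real_interp_integral B0 N0 B1 N1 \<theta> p x < \<infinity>"
    unfolding real_interp_space_def sum_space_def by auto
  have "(\<Sum>n. ennreal (\<Psi> n x / (2 * 2 powr p))) \<noteq> top"
    using real_interp_integral_comparable(2)[OF x] fin by (auto simp: top_unique)
  then have "summable (\<lambda>n. \<Psi> n x / (2 * 2 powr p))"
    by (intro summable_suminf_not_top) (simp_all add: \<Psi>_nonneg x)
  from summable_mult[OF this, of "2 * 2 powr p"] show "x \<in> lp_space"
    using x by (simp add: lp_space_def)
next
  fix x assume x: "x \<in> lp_space"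
  then have "\<exists>a\<in>B0. \<exists>b\<in>B1. x = a + b"
    using lp_spaceD(1) unfolding sum_space_def by blast
  then show "x \<in> real_interp_space B0 N0 B1 N1 \<theta> p"
    using real_interp_integral_lp_space(1)[OF x] unfolding real_interp_space_def
    by (auto intro: order_le_less_trans)
qed

lemma equivalent_norms_lp_norm:
  "equivalent_norms (real_interp_space B0 N0 B1 N1 \<theta> p) (real_interp_norm B0 N0 B1 N1 \<theta> p) lp_norm"
  unfolding equivalent_norms_def real_interp_space_eq
proof (rule exI[of _ "1 / 4"], rule conjI, simp, rule exI[of _ "(2 * 2 powr p) powr (1 / p)"],
    intro conjI ballI)
  fix x assume x: "x \<in> lp_space"
  define I where "I = enn2real (real_interp_integral B0 N0 B1 N1 \<theta> p x)"
  note bounds = real_interp_integral_lp_space[OF x]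
  have "real_interp_integral B0 N0 B1 N1 \<theta> p x < top"
    using bounds(1) by (auto intro: order_le_less_trans)
  then have I: "real_interp_integral B0 N0 B1 N1 \<theta> p x = ennreal I" "0 \<le> I"
    by (simp_all add: I_def)
  have upper: "I \<le> 4 powr p * \<Phi> x" and lower: "\<Phi> x \<le> (2 * 2 powr p) * I"
    using bounds I(2) \<Phi>_nonneg[OF x] unfolding I(1) by (auto simp: field_simps)
  have norm: "real_interp_norm B0 N0 B1 N1 \<theta> p x = I powr (1 / p)"
    by (simp add: real_interp_norm_def I_def)
  have "I powr (1 / p) \<le> (4 powr p * \<Phi> x) powr (1 / p)"
    using upper I(2) p_pos by (intro powr_mono2) auto
  also have "\<dots> = 4 * lp_norm x"
    using p_pos \<Phi>_nonneg[OF x] by (simp add: powr_mult powr_powr lp_norm_def)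
  finally show "1 / 4 * real_interp_norm B0 N0 B1 N1 \<theta> p x \<le> lp_norm x"
    by (simp add: norm)
  have "lp_norm x \<le> ((2 * 2 powr p) * I) powr (1 / p)"
    unfolding lp_norm_def using lower \<Phi>_nonneg[OF x] p_pos by (intro powr_mono2) auto
  also have "\<dots> = (2 * 2 powr p) powr (1 / p) * I powr (1 / p)"
    by (rule powr_mult)
  finally show "lp_norm x \<le> (2 * 2 powr p) powr (1 / p) * real_interp_norm B0 N0 B1 N1 \<theta> p x"
    by (simp add: norm)
qed auto

text \<open>The exponent \<open>1 - \<theta>\<close> is positive, so the indices encoding large
  positive integers give arbitrarily large weights.\<close>

lemma weight_unbounded: "\<exists>n. K < dyadic n powr (1 - \<theta>)"
proof -
  define c where "c = 1 - \<theta>"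
  have c: "0 < c" using \<theta>_less_1 by (simp add: c_def)
  obtain m where m: "\<bar>K\<bar> powr (1 / c) < 2 ^ m"
    using real_arch_pow[of 2] by auto
  have "dyadic (int_encode (int m)) = 2 ^ m"
    by (simp add: dyadic_def powr_realpow)
  then have "(\<bar>K\<bar> powr (1 / c)) powr c < dyadic (int_encode (int m)) powr c"
    using m c by (intro powr_less_mono2) auto
  then have "\<bar>K\<bar> < dyadic (int_encode (int m)) powr c"
    using c by (simp add: powr_powr)
  then show ?thesis
    unfolding c_def by (intro exI[of _ "int_encode (int m)"]) simp
qed

end

theorem theorem8p4:
  fixes scl :: "complex \<Rightarrow> 'v::{topological_ab_group_add, t2_space} \<Rightarrow> 'v"
    and B0 B1 :: "'v set" and N0 N1 :: "'v \<Rightarrow> real" and \<theta> p :: real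
  assumes "interpolation_couple scl B0 N0 B1 N1"
    and "0 < \<theta>" and "\<theta> < 1" and "1 < p"
    and "weakly_uniformly_rotund scl B0 N0"
  shows "\<exists>N. equivalent_norms (real_interp_space B0 N0 B1 N1 \<theta> p)
               (real_interp_norm B0 N0 B1 N1 \<theta> p) N \<and>
             weakly_uniformly_rotund scl (real_interp_space B0 N0 B1 N1 \<theta> p) N"
proof -
  interpret real_interpolation scl B0 N0 B1 N1 \<theta> p
    using assms by (simp add: real_interpolation_def real_interpolation_axioms_def)
  show ?thesis
    using equivalent_norms_lp_norm lp_weakly_uniformly_rotund[OF assms(5) weight_unbounded]
    unfolding real_interp_space_eq by blast
qed

end
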